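(* Let $G$ be a finitely generated infinite group. Suppose that for some symmetric probability measure $\mu$ on $G$ with finite generating support there is an unbounded function $\gamma:[1,\infty)\to\mathbb{R}_+=(0,\infty)$ such that both $\gamma(n)$ and $n^{1/2}/\gamma(n)$ are increasing, $\lim_{n\to\infty}\gamma(n)/n^{1/2}=0$, and $$\mu^{(2n)}(\mathrm{id})\ge\exp(-\gamma(n))\quad\text{for all integers } n\ge 1.$$ Let $\Gamma$ be a finitely generated group that is quasi-isometric to $G$. Then $(\Gamma,\eta)$ has the Liouville property for any symmetric probability measure $\eta$ of finite second moment on $\Gamma$.
   Context: A probability measure $\mu$ on a (discrete) group is symmetric if $\mu(g)=\mu(g^{-1})$ for all $g$; it has finite generating support if its support is a finite set that generates the group. $\mu^{(n)}$ denotes the $n$-fold convolution power of $\mu$, and $\mathrm{id}$ is the identity element. For a finitely generated group with a fixed finite generating set, $|g|$ is the word distance of $g$ from the identity; $\eta$ has finite second moment if $\sum_{g}|g|^2\eta(g)<\infty$ (this does not depend on the finite generating set). Quasi-isometry is with respect to word metrics. A function $h:\Gamma\to\mathbb{R}$ is $\eta$-harmonic if $h(x)=\sum_{y\in\Gamma}h(xy)\eta(y)$ for all $x\in\Gamma$. The pair $(\Gamma,\eta)$ has the Liouville property if all bounded $\eta$-harmonic functions on $\Gamma$ are constant.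
   Formalization: The support of η is additionally assumed to generate Γ; without this the claim is false (e.g. η = δ_id on ℤ), since the indicator of the subgroup generated by the support is a bounded non-constant η-harmonic function. *)

theory Defs
  imports "HOL-Algebra.Generated_Groups" "HOL-Probability.Probability"
begin

section \<open>Word metrics and quasi-isometry\<close>

definition finite_generating_set :: "('a, 'm) monoid_scheme \<Rightarrow> 'a set \<Rightarrow> bool" where
  "finite_generating_set G S \<longleftrightarrow>
     finite S \<and> S \<subseteq> carrier G \<and> generate G S = carrier G"

definition finitely_generated :: "('a, 'm) monoid_scheme \<Rightarrow> bool" where
  "finitely_generated G \<longleftrightarrow> (\<exists>S. finite_generating_set G S)"

text \<open>
  The set of lengths is nonempty exactly for the elements of the subgroup generated by \<open>S\<close>;
  the word length is only used for generating sets \<open>S\<close>.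
\<close>

definition word_length :: "('a, 'm) monoid_scheme \<Rightarrow> 'a set \<Rightarrow> 'a \<Rightarrow> nat" where
  "word_length G S g =
     (LEAST n. \<exists>ws. length ws = n \<and> set ws \<subseteq> S \<union> m_inv G ` S \<and>
                    foldr (\<otimes>\<^bsub>G\<^esub>) ws \<one>\<^bsub>G\<^esub> = g)"

definition word_dist :: "('a, 'm) monoid_scheme \<Rightarrow> 'a set \<Rightarrow> 'a \<Rightarrow> 'a \<Rightarrow> real" where
  "word_dist G S x y = real (word_length G S (inv\<^bsub>G\<^esub> x \<otimes>\<^bsub>G\<^esub> y))"

definition quasi_isometry ::
    "'a set \<Rightarrow> ('a \<Rightarrow> 'a \<Rightarrow> real) \<Rightarrow> 'b set \<Rightarrow> ('b \<Rightarrow> 'b \<Rightarrow> real) \<Rightarrow> ('a \<Rightarrow> 'b) \<Rightarrow> bool" where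
  "quasi_isometry X d Y e f \<longleftrightarrow>
     f \<in> X \<rightarrow> Y \<and>
     (\<exists>A B C. A \<ge> 1 \<and> B \<ge> 0 \<and> C \<ge> 0 \<and>
        (\<forall>x\<in>X. \<forall>x'\<in>X. d x x' / A - B \<le> e (f x) (f x') \<and> e (f x) (f x') \<le> A * d x x' + B) \<and>
        (\<forall>y\<in>Y. \<exists>x\<in>X. e (f x) y \<le> C))"

text \<open>
  For finitely generated groups the choice of the two finite generating sets does not matter, since
  word metrics of different finite generating sets are bi-Lipschitz equivalent.
\<close>

definition quasi_isometric_groups ::
    "('a, 'm) monoid_scheme \<Rightarrow> ('b, 'n) monoid_scheme \<Rightarrow> bool" where
  "quasi_isometric_groups G H \<longleftrightarrow>
     (\<exists>S T f. finite_generating_set G S \<and> finite_generating_set H T \<and>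
        quasi_isometry (carrier G) (word_dist G S) (carrier H) (word_dist H T) f)"

section \<open>Probability measures on groups\<close>

text \<open>
  A probability measure on the discrete group \<open>G\<close> is a probability mass function on the ambient
  type whose support is contained in the carrier of \<open>G\<close>.
\<close>

definition prob_measure_on :: "('a, 'm) monoid_scheme \<Rightarrow> 'a pmf \<Rightarrow> bool" where
  "prob_measure_on G \<mu> \<longleftrightarrow> set_pmf \<mu> \<subseteq> carrier G"

definition symmetric_pmf :: "('a, 'm) monoid_scheme \<Rightarrow> 'a pmf \<Rightarrow> bool" where
  "symmetric_pmf G \<mu> \<longleftrightarrow> (\<forall>g\<in>carrier G. pmf \<mu> g = pmf \<mu> (inv\<^bsub>G\<^esub> g))"

text \<open>
  Nondegeneracy of a measure.  It is necessary for the Liouville property defined below: the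
  indicator function of the subgroup generated by the support is bounded and harmonic.
  Generation as a group and as a semigroup agree for symmetric measures.
\<close>

definition generating_support :: "('a, 'm) monoid_scheme \<Rightarrow> 'a pmf \<Rightarrow> bool" where
  "generating_support G \<mu> \<longleftrightarrow> generate G (set_pmf \<mu>) = carrier G"

definition finite_generating_support :: "('a, 'm) monoid_scheme \<Rightarrow> 'a pmf \<Rightarrow> bool" where
  "finite_generating_support G \<mu> \<longleftrightarrow> finite (set_pmf \<mu>) \<and> generating_support G \<mu>"

definition convolution_pmf :: "('a, 'm) monoid_scheme \<Rightarrow> 'a pmf \<Rightarrow> 'a pmf \<Rightarrow> 'a pmf" where
  "convolution_pmf G \<mu> \<nu> = map_pmf (\<lambda>(x, y). x \<otimes>\<^bsub>G\<^esub> y) (pair_pmf \<mu> \<nu>)"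

primrec convolution_power :: "('a, 'm) monoid_scheme \<Rightarrow> 'a pmf \<Rightarrow> nat \<Rightarrow> 'a pmf" where
  "convolution_power G \<mu> 0 = return_pmf \<one>\<^bsub>G\<^esub>"
| "convolution_power G \<mu> (Suc n) = convolution_pmf G (convolution_power G \<mu> n) \<mu>"

text \<open>Again the choice of the finite generating set does not matter.\<close>

definition finite_second_moment :: "('a, 'm) monoid_scheme \<Rightarrow> 'a pmf \<Rightarrow> bool" where
  "finite_second_moment G \<eta> \<longleftrightarrow>
     (\<exists>S. finite_generating_set G S \<and>
        (\<lambda>g. (real (word_length G S g))\<^sup>2 * pmf \<eta> g) summable_on carrier G)"

section \<open>Harmonic functions and the Liouville property\<close>

definition harmonic :: "('a, 'm) monoid_scheme \<Rightarrow> 'a pmf \<Rightarrow> ('a \<Rightarrow> real) \<Rightarrow> bool" where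
  "harmonic G \<eta> h \<longleftrightarrow>
     (\<forall>x\<in>carrier G. ((\<lambda>y. h (x \<otimes>\<^bsub>G\<^esub> y) * pmf \<eta> y) has_sum h x) (carrier G))"

definition liouville_property :: "('a, 'm) monoid_scheme \<Rightarrow> 'a pmf \<Rightarrow> bool" where
  "liouville_property G \<eta> \<longleftrightarrow>
     (\<forall>h. harmonic G \<eta> h \<and> bounded (h ` carrier G) \<longrightarrow> h constant_on carrier G)"

end

theory Submission
  imports Defs
begin

text \<open>
  The proof follows the entropy of the walk driven by \<open>\<eta>\<close>.  If the laws of the position \<open>X\<^sub>t\<close> satisfy
  \<open>H (X\<^sub>t) = o (t)\<close> along a sequence of times, then \<open>\<eta>\<close> has the Liouville property: \<open>H (X\<^sub>t)\<close> is a sum of \<open>t\<close>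
  increments, each increment is the mutual information of the first step and the position, and if it is small,
  then conditioning on the first step hardly changes the law of the position.  A bounded harmonic function, which
  is the mean of its values at the position, then does not change along the first step
  (\<open>likelihood_deficit_le_entropy_increment\<close>, \<open>abs_harmonic_diff_le\<close>).

  The entropy is \<open>o (t)\<close> as soon as the walk at time \<open>t\<close> lies with probability close to 1 in a set of
  \<open>exp (o (t))\<close> elements, for the exceptional event contributes only its part of the mean word length, which is
  controlled by the second moment (\<open>liouville_if_concentrated\<close>).

  Such sets are supports of functions with small Rayleigh quotient.  Write \<open>\<lambda>\<close> for the quotient of Dirichlet
  energy and square norm of a finitely supported function.  The walk with step law \<open>\<eta>\<close>, started at a suitable
  point of the support, is outside the support at time \<open>t\<close> with probability at most \<open>t \<lambda> / 2\<close>, for \<open>t\<close> a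
  power of 2 and a nonnegative function
  (\<open>dirichlet_energy_dyadic\<close>, \<open>concentration_of_small_energy\<close>).

  On \<open>G\<close> functions of this kind come from the return probabilities: for each \<open>n\<close>, the truncated sum
  of two consecutive convolution powers of \<open>\<mu>\<close>, chosen suitably below \<open>n\<close>, gives a support of at most \<open>16 exp (\<gamma> n)\<close> elements and a quotient of order \<open>(\<gamma> n + 1) / n\<close>
  (\<open>ex_small_energy_of_return_probability\<close>).  Unlike the return probabilities themselves, these functions are easily
  carried to \<open>\<Gamma>\<close>, with a constant loss in support and quotient (\<open>quasi_isometry_transfers_energy\<close>); and the
  energy for \<open>\<eta>\<close> is at most the second moment of \<open>\<eta>\<close> times the energy for a finite generating set
  (\<open>dirichlet_energy_le_second_moment\<close>).

  With \<open>t = \<surd>n\<close> both \<open>t \<lambda>\<close> and the logarithm of the support divided by \<open>t\<close> are of order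
  \<open>(\<gamma> n + 1) / \<surd>n\<close>, which tends to 0.
\<close>

section \<open>Convolution of measures on a group\<close>

lemma symmetric_pmf_map_inv:
  assumes "group G" and "prob_measure_on G p" and "symmetric_pmf G p"
  shows "map_pmf (m_inv G) p = p"
proof (rule pmf_eqI)
  interpret group G by fact
  have sub: "set_pmf p \<subseteq> carrier G" using assms(2) by (simp add: prob_measure_on_def)
  fix x
  show "pmf (map_pmf (m_inv G) p) x = pmf p x"
  proof (cases "x \<in> carrier G")
    case True
    have "pmf (map_pmf (m_inv G) p) x = measure p (m_inv G -` {x})" by (simp add: pmf_map)
    also have "\<dots> = measure p {inv\<^bsub>G\<^esub> x}"
    proof (rule measure_prob_cong_0)
      fix y assume y: "y \<in> m_inv G -` {x} - {inv\<^bsub>G\<^esub> x}"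
      show "pmf p y = 0"
      proof (rule ccontr)
        assume "pmf p y \<noteq> 0"
        then have "y \<in> carrier G" using sub by (auto simp: set_pmf_iff)
        then show False using y by auto
      qed
    qed (use True in auto)
    finally have "pmf (map_pmf (m_inv G) p) x = pmf p (inv\<^bsub>G\<^esub> x)" by (simp add: measure_pmf_single)
    also have "\<dots> = pmf p x"
      using True assms(3) unfolding symmetric_pmf_def by metis
    finally show ?thesis .
  next
    case False
    have "x \<notin> set_pmf p" using False sub by auto
    moreover have "x \<notin> set_pmf (map_pmf (m_inv G) p)" using False sub by auto
    ultimately show ?thesis by (metis pmf_eq_0_set_pmf)
  qed
qed

context group
begin

lemma prob_measure_on_convolution_pmf:
  assumes "prob_measure_on G p" and "prob_measure_on G q"
  shows "prob_measure_on G (convolution_pmf G p q)"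
  using assms by (auto simp: prob_measure_on_def convolution_pmf_def)

lemma prob_measure_on_convolution_power:
  assumes "prob_measure_on G p"
  shows "prob_measure_on G (convolution_power G p n)"
proof (induction n)
  case 0
  then show ?case by (simp add: prob_measure_on_def)
next
  case (Suc n)
  then show ?case using assms by (simp add: prob_measure_on_convolution_pmf)
qed

lemma convolution_pmf_assoc:
  assumes "prob_measure_on G p" and "prob_measure_on G q" and "prob_measure_on G r"
  shows "convolution_pmf G (convolution_pmf G p q) r = convolution_pmf G p (convolution_pmf G q r)"
proof -
  have "convolution_pmf G (convolution_pmf G p q) r
      = map_pmf (\<lambda>(x, y, z). (x \<otimes> y) \<otimes> z) (pair_pmf p (pair_pmf q r))"
    unfolding convolution_pmf_def pair_map_pmf1 pair_pair_pmf pmf.map_comp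
    by (intro map_pmf_cong) auto
  also have "\<dots> = map_pmf (\<lambda>(x, y, z). x \<otimes> (y \<otimes> z)) (pair_pmf p (pair_pmf q r))"
    using assms by (intro map_pmf_cong) (auto simp: prob_measure_on_def m_assoc subset_iff)
  also have "\<dots> = convolution_pmf G p (convolution_pmf G q r)"
    unfolding convolution_pmf_def pair_map_pmf2 pmf.map_comp
    by (intro map_pmf_cong) auto
  finally show ?thesis .
qed

lemma convolution_pmf_one_left:
  assumes "prob_measure_on G p" shows "convolution_pmf G (return_pmf \<one>) p = p"
proof -
  have "convolution_pmf G (return_pmf \<one>) p = map_pmf (\<lambda>x. \<one> \<otimes> x) p"
    by (simp add: convolution_pmf_def pair_return_pmf1 pmf.map_comp o_def)
  also have "\<dots> = map_pmf (\<lambda>x. x) p"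
    using assms by (intro map_pmf_cong) (auto simp: prob_measure_on_def)
  finally show ?thesis by simp
qed

lemma convolution_pmf_one_right:
  assumes "prob_measure_on G p" shows "convolution_pmf G p (return_pmf \<one>) = p"
proof -
  have "convolution_pmf G p (return_pmf \<one>) = map_pmf (\<lambda>x. x \<otimes> \<one>) p"
    by (simp add: convolution_pmf_def pair_return_pmf2 pmf.map_comp o_def)
  also have "\<dots> = map_pmf (\<lambda>x. x) p"
    using assms by (intro map_pmf_cong) (auto simp: prob_measure_on_def)
  finally show ?thesis by simp
qed

lemma convolution_power_add:
  assumes "prob_measure_on G p"
  shows "convolution_power G p (m + n)
       = convolution_pmf G (convolution_power G p m) (convolution_power G p n)"
proof (induction n)
  case 0
  then show ?case
    using assms by (simp add: convolution_pmf_one_right prob_measure_on_convolution_power)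
next
  case (Suc n)
  then show ?case
    using assms by (simp add: convolution_pmf_assoc prob_measure_on_convolution_power)
qed

lemma convolution_power_Suc_left:
  assumes "prob_measure_on G p"
  shows "convolution_power G p (Suc n) = convolution_pmf G p (convolution_power G p n)"
  using convolution_power_add[OF assms, of 1 n] assms
  by (simp add: convolution_pmf_one_left)

lemma map_inv_convolution_pmf:
  assumes "prob_measure_on G p" and "prob_measure_on G q"
  shows "map_pmf (m_inv G) (convolution_pmf G p q)
       = convolution_pmf G (map_pmf (m_inv G) q) (map_pmf (m_inv G) p)"
proof -
  have "map_pmf (m_inv G) (convolution_pmf G p q)
      = map_pmf (\<lambda>(x, y). inv y \<otimes> inv x) (pair_pmf p q)"
    using assms unfolding convolution_pmf_def pmf.map_comp
    by (intro map_pmf_cong) (auto simp: prob_measure_on_def inv_mult_group subset_iff)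
  also have "\<dots> = map_pmf (\<lambda>(y, x). inv y \<otimes> inv x) (pair_pmf q p)"
    unfolding pair_commute_pmf[of p q] pmf.map_comp by (intro map_pmf_cong) auto
  also have "\<dots> = convolution_pmf G (map_pmf (m_inv G) q) (map_pmf (m_inv G) p)"
    unfolding convolution_pmf_def map_pair[symmetric] pmf.map_comp by (intro map_pmf_cong) auto
  finally show ?thesis .
qed

lemma map_inv_convolution_power:
  assumes "prob_measure_on G p" and "map_pmf (m_inv G) p = p"
  shows "map_pmf (m_inv G) (convolution_power G p n) = convolution_power G p n"
proof (induction n)
  case (Suc n)
  have "map_pmf (m_inv G) (convolution_power G p (Suc n))
      = convolution_pmf G p (convolution_power G p n)"
    using assms Suc by (simp add: map_inv_convolution_pmf prob_measure_on_convolution_power)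
  then show ?case using convolution_power_Suc_left[OF assms(1)] by simp
qed simp

lemma pmf_inv:
  assumes "prob_measure_on G p" and "map_pmf (m_inv G) p = p" and "x \<in> carrier G"
  shows "pmf p (inv x) = pmf p x"
proof -
  have "pmf p (inv x) = pmf (map_pmf (m_inv G) p) (inv x)" by (simp add: assms(2))
  also have "\<dots> = measure p (m_inv G -` {inv x})" by (simp add: pmf_map)
  also have "\<dots> = measure p {x}"
  proof (rule measure_prob_cong_0)
    fix y assume y: "y \<in> m_inv G -` {inv x} - {x}"
    show "pmf p y = 0"
    proof (rule ccontr)
      assume "pmf p y \<noteq> 0"
      then have "y \<in> carrier G" using assms(1) by (auto simp: set_pmf_iff prob_measure_on_def)
      then show False using y assms(3) inv_inv by (metis DiffD1 DiffD2 singletonD singletonI vimage_singleton_eq)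
    qed
  qed (use assms(3) in auto)
  finally show ?thesis by (simp add: measure_pmf_single)
qed

lemma pmf_convolution_ge:
  "pmf p x * pmf q y \<le> pmf (convolution_pmf G p q) (x \<otimes> y)"
proof -
  have "pmf p x * pmf q y = measure (pair_pmf p q) {(x, y)}"
    by (simp add: measure_pmf_single pmf_pair)
  also have "\<dots> \<le> measure (pair_pmf p q) ((\<lambda>(x, y). x \<otimes> y) -` {x \<otimes> y})"
    by (intro measure_pmf.finite_measure_mono) auto
  finally show ?thesis by (simp add: convolution_pmf_def pmf_map)
qed

end

section \<open>Word length\<close>

locale word_metric = group G for G (structure) +
  fixes S :: "'a set"
  assumes fgs: "finite_generating_set G S"
begin

abbreviation letters :: "'a set" where "letters \<equiv> S \<union> m_inv G ` S"

abbreviation eval_word :: "'a list \<Rightarrow> 'a" where "eval_word ws \<equiv> foldr (\<otimes>) ws \<one>"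

abbreviation wl :: "'a \<Rightarrow> nat" where "wl \<equiv> word_length G S"

lemma finite_letters: "finite letters" and letters_carrier: "letters \<subseteq> carrier G"
  using fgs by (auto simp: finite_generating_set_def)

lemma eval_word_closed: "set ws \<subseteq> letters \<Longrightarrow> eval_word ws \<in> carrier G"
  using letters_carrier by (induction ws) auto

lemma eval_word_append:
  assumes "set ws \<subseteq> letters" and "set vs \<subseteq> letters"
  shows "eval_word (ws @ vs) = eval_word ws \<otimes> eval_word vs"
  using assms
proof (induction ws)
  case (Cons w ws)
  then have "w \<in> carrier G" "eval_word ws \<in> carrier G" "eval_word vs \<in> carrier G"
    using letters_carrier eval_word_closed by auto
  then show ?case using Cons by (simp add: m_assoc)
qed (use eval_word_closed in simp)

lemma ex_word:
  assumes "g \<in> carrier G"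
  shows "\<exists>ws. set ws \<subseteq> letters \<and> eval_word ws = g"
proof -
  have "g \<in> generate G S" using assms fgs by (simp add: finite_generating_set_def)
  then show ?thesis
  proof induction
    case one
    then show ?case by (intro exI[of _ "[]"]) auto
  next
    case (incl h)
    then show ?case using letters_carrier by (intro exI[of _ "[h]"]) auto
  next
    case (inv h)
    then show ?case using letters_carrier by (intro exI[of _ "[inv h]"]) auto
  next
    case (eng h1 h2)
    then obtain ws vs where "set ws \<subseteq> letters \<and> eval_word ws = h1" "set vs \<subseteq> letters \<and> eval_word vs = h2"
      by blast
    then show ?case using eval_word_append[of ws vs] by (intro exI[of _ "ws @ vs"]) auto
  qed
qed

lemma ex_geodesic_word:
  assumes "g \<in> carrier G"
  shows "\<exists>ws. length ws = wl g \<and> set ws \<subseteq> letters \<and> eval_word ws = g"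
proof -
  have "\<exists>n ws. length ws = n \<and> set ws \<subseteq> letters \<and> eval_word ws = g"
    using ex_word[OF assms] by blast
  then show ?thesis unfolding word_length_def by (rule LeastI_ex)
qed

lemma word_length_eval_word_le:
  assumes "set ws \<subseteq> letters"
  shows "wl (eval_word ws) \<le> length ws"
  unfolding word_length_def by (rule Least_le) (use assms in blast)

lemma word_length_one: "wl \<one> = 0"
  using word_length_eval_word_le[of "[]"] by simp

lemma word_length_mult_le:
  assumes "g \<in> carrier G" and "h \<in> carrier G"
  shows "wl (g \<otimes> h) \<le> wl g + wl h"
proof -
  obtain ws vs where ws: "length ws = wl g" "set ws \<subseteq> letters" "eval_word ws = g"
    and vs: "length vs = wl h" "set vs \<subseteq> letters" "eval_word vs = h"
    using assms ex_geodesic_word by meson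
  show ?thesis
    using word_length_eval_word_le[of "ws @ vs"] eval_word_append[of ws vs] ws vs by auto
qed

lemma finite_word_ball: "finite {g \<in> carrier G. wl g \<le> n}"
proof (rule finite_subset)
  show "{g \<in> carrier G. wl g \<le> n} \<subseteq> eval_word ` {ws. set ws \<subseteq> letters \<and> length ws \<le> n}"
    using ex_geodesic_word by fastforce
  show "finite (eval_word ` {ws. set ws \<subseteq> letters \<and> length ws \<le> n})"
    using finite_lists_length_le[OF finite_letters] by simp
qed

text \<open>
  The reference measure \<open>q\<close> is the law of a word of geometric length in uniform letters: a geodesic
  word for \<open>g\<close> is one way to produce \<open>g\<close>, and its probability is exponential in its length.  By the
  Gibbs inequality such a \<open>q\<close> turns a bound on the mean word length into a bound on entropy.
\<close>

lemma ex_exponential_reference_pmf: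
  "\<exists>q a. a \<ge> 0 \<and> (\<forall>g \<in> carrier G. pmf q g > 0 \<and> - ln (pmf q g) \<le> ln 2 + a * real (wl g))"
proof -
  \<comment> \<open>The identity is added so that the alphabet is nonempty even for the empty generating set.\<close>
  define A where "A = insert \<one> letters"
  have A: "finite A" "A \<noteq> {}" "A \<subseteq> carrier G" and one_A: "\<one> \<in> A"
    using finite_letters letters_carrier by (auto simp: A_def)
  define \<nu> where "\<nu> = pmf_of_set A"
  have \<nu>: "pmf \<nu> w = 1 / card A" if "w \<in> A" for w
    using A that by (simp add: \<nu>_def)
  define L where "L = real (card A)"
  have L: "L \<ge> 1" using A by (simp add: L_def Suc_leI card_gt_0_iff)
  have \<nu>_on: "prob_measure_on G \<nu>" using A by (simp add: prob_measure_on_def \<nu>_def)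
  have word: "(1 / L) ^ length ws \<le> pmf (convolution_power G \<nu> (length ws)) (eval_word ws)"
    if "set ws \<subseteq> letters" for ws
    using that
  proof (induction ws)
    case (Cons w ws)
    have "(1 / L) ^ length (w # ws) \<le> pmf \<nu> w * pmf (convolution_power G \<nu> (length ws)) (eval_word ws)"
      using Cons \<nu>[of w] L by (simp add: A_def L_def mult_left_mono divide_right_mono)
    also have "\<dots> \<le> pmf (convolution_pmf G \<nu> (convolution_power G \<nu> (length ws))) (w \<otimes> eval_word ws)"
      by (rule pmf_convolution_ge)
    finally show ?case using convolution_power_Suc_left[OF \<nu>_on] by simp
  qed simp
  define q where "q = bind_pmf (geometric_pmf (1/2)) (\<lambda>n. convolution_power G \<nu> n)"
  have q: "(1/2) * (1 / (2 * L)) ^ wl g \<le> pmf q g" if g: "g \<in> carrier G" for g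
  proof -
    obtain ws where ws: "length ws = wl g" "set ws \<subseteq> letters" "eval_word ws = g"
      using ex_geodesic_word[OF g] by blast
    have "(1/2) * (1 / (2 * L)) ^ wl g = (1 / L) ^ wl g * ((1/2) ^ wl g * (1/2))"
      by (simp add: power_divide power_mult_distrib)
    also have "\<dots> \<le> pmf (convolution_power G \<nu> (wl g)) g * pmf (geometric_pmf (1/2)) (wl g)"
      using word[OF ws(2)] ws by (intro mult_mono) auto
    also have "\<dots> = (\<integral>n. pmf (convolution_power G \<nu> n) g * indicator {wl g} n \<partial>geometric_pmf (1/2))"
      by (subst integral_measure_pmf[of "{wl g}"]) (auto simp: indicator_def)
    also have "\<dots> \<le> (\<integral>n. pmf (convolution_power G \<nu> n) g \<partial>geometric_pmf (1/2))"
      by (intro integral_mono measure_pmf.integrable_const_bound[where B = 1])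
        (auto simp: indicator_def pmf_le_1)
    also have "\<dots> = pmf q g" by (simp add: q_def pmf_bind)
    finally show ?thesis .
  qed
  show ?thesis
  proof (intro exI[of _ q] exI[of _ "ln (2 * L)"] conjI ballI)
    show "0 \<le> ln (2 * L)" using L by simp
    fix g assume g: "g \<in> carrier G"
    have pos: "0 < (1/2) * (1 / (2 * L)) ^ wl g" using L by simp
    then show q_pos: "0 < pmf q g" using q[OF g] by linarith
    have "ln ((1/2) * (1 / (2 * L)) ^ wl g) \<le> ln (pmf q g)"
      using q[OF g] pos q_pos by (subst ln_le_cancel_iff) auto
    moreover have "ln ((1/2) * (1 / (2 * L)) ^ wl g) = - ln 2 - wl g * ln (2 * L)"
      using L by (simp add: ln_mult ln_div ln_realpow right_diff_distrib distrib_left)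
    ultimately show "- ln (pmf q g) \<le> ln 2 + ln (2 * L) * real (wl g)"
      by (simp add: mult.commute)
  qed
qed

end

section \<open>Expectations of probability mass functions\<close>

text \<open>
  Fubini for signed integrands.  Boundedness allows a shift to a nonnegative integrand, for which the
  iterated integral is the nonnegative one.
\<close>

lemma expectation_pair_pmf_bounded:
  fixes p :: "'a pmf" and q :: "'b pmf" and f :: "'a \<times> 'b \<Rightarrow> real"
  assumes bd: "\<And>x y. x \<in> set_pmf p \<Longrightarrow> y \<in> set_pmf q \<Longrightarrow> \<bar>f (x, y)\<bar> \<le> K"
  shows "(\<integral>z. f z \<partial>pair_pmf p q) = (\<integral>x. (\<integral>y. f (x, y) \<partial>q) \<partial>p)"
proof -
  let ?g = "\<lambda>z. f z + K"
  have int: "integrable (pair_pmf p q) f"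
    using bd by (intro measure_pmf.integrable_const_bound[where B = K]) (auto simp: AE_measure_pmf_iff)
  have int_y: "integrable q (\<lambda>y. f (x, y))" if "x \<in> set_pmf p" for x
    using bd that by (intro measure_pmf.integrable_const_bound[where B = K]) (auto simp: AE_measure_pmf_iff)
  have abs_le: "\<bar>\<integral>y. f (x, y) \<partial>q\<bar> \<le> K" if x: "x \<in> set_pmf p" for x
  proof -
    have "(\<integral>y. f (x, y) \<partial>q) \<le> (\<integral>y. K \<partial>q)"
      using bd[OF x] int_y[OF x] by (intro integral_mono_AE) (auto simp: AE_measure_pmf_iff abs_le_iff)
    moreover have "(\<integral>y. - K \<partial>q) \<le> (\<integral>y. f (x, y) \<partial>q)"
      using bd[OF x] int_y[OF x] by (intro integral_mono_AE) (force simp: AE_measure_pmf_iff abs_le_iff)+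
    ultimately show ?thesis by simp
  qed
  have int_x: "integrable p (\<lambda>x. \<integral>y. f (x, y) \<partial>q)"
    using abs_le by (intro measure_pmf.integrable_const_bound[where B = K]) (auto simp: AE_measure_pmf_iff)
  have nonneg: "0 \<le> f (x, y) + K" if "x \<in> set_pmf p" "y \<in> set_pmf q" for x y
    using bd[OF that] by linarith
  have "ennreal (\<integral>z. ?g z \<partial>pair_pmf p q) = (\<integral>\<^sup>+z. ennreal (?g z) \<partial>pair_pmf p q)"
    using int nonneg by (intro nn_integral_eq_integral[symmetric]) (auto simp: AE_measure_pmf_iff)
  also have "\<dots> = (\<integral>\<^sup>+x. \<integral>\<^sup>+y. ennreal (?g (x, y)) \<partial>q \<partial>p)" by (rule nn_integral_pair_pmf')
  also have "\<dots> = (\<integral>\<^sup>+x. ennreal ((\<integral>y. f (x, y) \<partial>q) + K) \<partial>p)"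
  proof (rule nn_integral_cong_AE, rule AE_pmfI)
    fix x assume x: "x \<in> set_pmf p"
    have "(\<integral>\<^sup>+y. ennreal (?g (x, y)) \<partial>q) = ennreal (\<integral>y. ?g (x, y) \<partial>q)"
      using int_y[OF x] nonneg[OF x] by (intro nn_integral_eq_integral) (auto simp: AE_measure_pmf_iff)
    then show "(\<integral>\<^sup>+y. ennreal (?g (x, y)) \<partial>q) = ennreal ((\<integral>y. f (x, y) \<partial>q) + K)"
      using int_y[OF x] by simp
  qed
  also have "\<dots> = ennreal (\<integral>x. (\<integral>y. f (x, y) \<partial>q) + K \<partial>p)"
    using int_x abs_le by (intro nn_integral_eq_integral) (force simp: AE_measure_pmf_iff abs_le_iff)+
  finally have eq: "ennreal (\<integral>z. ?g z \<partial>pair_pmf p q) = ennreal (\<integral>x. (\<integral>y. f (x, y) \<partial>q) + K \<partial>p)" .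
  have "0 \<le> (\<integral>z. ?g z \<partial>pair_pmf p q)"
    using nonneg by (intro integral_nonneg_AE) (auto simp: AE_measure_pmf_iff)
  moreover have "0 \<le> (\<integral>x. (\<integral>y. f (x, y) \<partial>q) + K \<partial>p)"
    using abs_le by (intro integral_nonneg_AE) (force simp: AE_measure_pmf_iff abs_le_iff)
  ultimately have "(\<integral>z. ?g z \<partial>pair_pmf p q) = (\<integral>x. (\<integral>y. f (x, y) \<partial>q) + K \<partial>p)"
    using eq by simp
  then show ?thesis using int int_x by simp
qed

text \<open>
  Only an inequality holds, because the part of \<open>r\<close> outside the support of \<open>p\<close> is not seen by \<open>p\<close>.
\<close>

lemma change_of_measure:
  fixes p r :: "'a pmf" and w :: "'a \<Rightarrow> real"
  assumes "integrable r w" and "\<And>x. 0 \<le> w x"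
  shows "integrable p (\<lambda>x. pmf r x / pmf p x * w x)"
    and "(\<integral>x. pmf r x / pmf p x * w x \<partial>p) \<le> (\<integral>x. w x \<partial>r)"
proof -
  have "(\<integral>\<^sup>+x. ennreal (pmf r x / pmf p x * w x) \<partial>p)
      = (\<integral>\<^sup>+x. ennreal (pmf p x) * ennreal (pmf r x / pmf p x * w x) \<partial>count_space UNIV)"
    by (rule nn_integral_measure_pmf)
  also have "\<dots> \<le> (\<integral>\<^sup>+x. ennreal (pmf r x) * ennreal (w x) \<partial>count_space UNIV)"
  proof (rule nn_integral_mono)
    fix x
    show "ennreal (pmf p x) * ennreal (pmf r x / pmf p x * w x) \<le> ennreal (pmf r x) * ennreal (w x)"
      using assms(2) by (cases "pmf p x = 0") (auto simp: ennreal_mult[symmetric])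
  qed
  also have "\<dots> = (\<integral>\<^sup>+x. ennreal (w x) \<partial>r)" by (rule nn_integral_measure_pmf[symmetric])
  also have "\<dots> = ennreal (\<integral>x. w x \<partial>r)"
    using assms by (intro nn_integral_eq_integral) auto
  finally have le: "(\<integral>\<^sup>+x. ennreal (pmf r x / pmf p x * w x) \<partial>p) \<le> ennreal (\<integral>x. w x \<partial>r)" .
  show int: "integrable p (\<lambda>x. pmf r x / pmf p x * w x)"
    using assms(2) le by (intro integrableI_bounded) (auto simp: less_top[symmetric] top_unique)
  have "ennreal (\<integral>x. pmf r x / pmf p x * w x \<partial>p) \<le> ennreal (\<integral>x. w x \<partial>r)"
    using le nn_integral_eq_integral[OF int] assms(2) by simp
  then show "(\<integral>x. pmf r x / pmf p x * w x \<partial>p) \<le> (\<integral>x. w x \<partial>r)"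
    using assms(2) by (simp add: ennreal_le_iff integral_nonneg_AE)
qed

lemma expectation_likelihood_ratio_le_one:
  "integrable (measure_pmf p) (\<lambda>x. pmf r x / pmf p x)" "(\<integral>x. pmf r x / pmf p x \<partial>p) \<le> 1"
  using change_of_measure[of r "\<lambda>_. 1" p] by auto

text \<open>
  Where the likelihood ratio exceeds 1, passing from \<open>p\<close> to \<open>r\<close> can only raise the mean of a
  nonnegative function.  Hence only the deficit of the ratio below 1 is needed, and it is an expectation
  with respect to \<open>p\<close> alone, where the ratio is meaningful.
\<close>

lemma expectation_diff_le_likelihood_deficit:
  fixes p r :: "'a pmf" and w :: "'a \<Rightarrow> real"
  assumes w: "\<And>x. 0 \<le> w x" "\<And>x. w x \<le> M"
  shows "(\<integral>x. w x \<partial>p) - (\<integral>x. w x \<partial>r) \<le> M * (\<integral>x. max 0 (1 - pmf r x / pmf p x) \<partial>p)"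
proof -
  have w_int: "integrable (measure_pmf s) w" for s
    using w by (intro measure_pmf.integrable_const_bound[where B = M]) auto
  note ratio = change_of_measure[of r w p, OF w_int w(1)]
  have d_int: "integrable p (\<lambda>x. max 0 (1 - pmf r x / pmf p x))"
    by (intro measure_pmf.integrable_const_bound[where B = 1]) auto
  have "(\<integral>x. w x \<partial>p) - (\<integral>x. w x \<partial>r) \<le> (\<integral>x. w x \<partial>p) - (\<integral>x. pmf r x / pmf p x * w x \<partial>p)"
    using ratio(2) by simp
  also have "\<dots> = (\<integral>x. w x - pmf r x / pmf p x * w x \<partial>p)"
    using w_int ratio(1) by simp
  also have "\<dots> \<le> (\<integral>x. M * max 0 (1 - pmf r x / pmf p x) \<partial>p)"
  proof (rule integral_mono)
    fix x
    have "w x - pmf r x / pmf p x * w x = w x * (1 - pmf r x / pmf p x)" by (simp add: algebra_simps)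
    also have "\<dots> \<le> w x * max 0 (1 - pmf r x / pmf p x)" using w(1) by (intro mult_left_mono) auto
    also have "\<dots> \<le> M * max 0 (1 - pmf r x / pmf p x)" using w(2) by (intro mult_right_mono) auto
    finally show "w x - pmf r x / pmf p x * w x \<le> M * max 0 (1 - pmf r x / pmf p x)" .
  qed (use w_int ratio(1) d_int in auto)
  finally show ?thesis by simp
qed

section \<open>Shannon entropy\<close>

definition shannon_entropy :: "'a pmf \<Rightarrow> real" where
  "shannon_entropy p = - (\<integral>x. ln (pmf p x) \<partial>p)"

definition finite_entropy :: "'a pmf \<Rightarrow> bool" where
  "finite_entropy p \<longleftrightarrow> integrable (measure_pmf p) (\<lambda>x. ln (pmf p x))"

text \<open>
  The cross entropy \<open>- \<integral> ln r dp\<close> dominates the entropy of \<open>p\<close>.  Every choice of a reference measure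
  \<open>r\<close> thus gives an upper bound, and also the integrability of \<open>ln p\<close>.
\<close>

lemma gibbs_inequality:
  fixes p r :: "'a pmf" and b :: "'a \<Rightarrow> real"
  assumes pos: "\<And>x. x \<in> set_pmf p \<Longrightarrow> 0 < pmf r x"
    and le: "\<And>x. x \<in> set_pmf p \<Longrightarrow> - ln (pmf r x) \<le> b x" and int: "integrable p b"
  shows "finite_entropy p" and "shannon_entropy p \<le> (\<integral>x. b x \<partial>p)"
proof -
  have pointwise: "- ln (pmf p x) \<le> b x + (pmf r x / pmf p x - 1)" if x: "x \<in> set_pmf p" for x
  proof -
    have p: "0 < pmf p x" using x by (simp add: pmf_positive)
    have "ln (pmf r x / pmf p x) \<le> pmf r x / pmf p x - 1"
      using p pos[OF x] by (intro ln_le_minus_one) simp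
    then show ?thesis using le[OF x] p pos[OF x] by (simp add: ln_div)
  qed
  have int': "integrable p (\<lambda>x. b x + (pmf r x / pmf p x - 1))"
    using int expectation_likelihood_ratio_le_one(1)[where p = p and r = r] by simp
  have "integrable p (\<lambda>x. - ln (pmf p x))"
  proof (rule Bochner_Integration.integrable_bound[OF int'])
    show "AE x in measure_pmf p. norm (- ln (pmf p x)) \<le> norm (b x + (pmf r x / pmf p x - 1))"
    proof (rule AE_pmfI)
      fix x assume x: "x \<in> set_pmf p"
      have "ln (pmf p x) \<le> 0" using x by (simp add: pmf_positive pmf_le_1)
      then show "norm (- ln (pmf p x)) \<le> norm (b x + (pmf r x / pmf p x - 1))"
        using pointwise[OF x] by simp
    qed
  qed simp
  then show fin: "finite_entropy p" by (simp add: finite_entropy_def)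
  have "shannon_entropy p = (\<integral>x. - ln (pmf p x) \<partial>p)" by (simp add: shannon_entropy_def)
  also have "\<dots> \<le> (\<integral>x. b x + (pmf r x / pmf p x - 1) \<partial>p)"
    using fin int' pointwise
    by (intro integral_mono_AE) (auto simp: finite_entropy_def AE_measure_pmf_iff)
  also have "\<dots> \<le> (\<integral>x. b x \<partial>p)" using int expectation_likelihood_ratio_le_one[where p = p and r = r] by simp
  finally show "shannon_entropy p \<le> (\<integral>x. b x \<partial>p)" .
qed

text \<open>
  This replaces Pinsker's inequality: integrated against \<open>p\<close> with \<open>s = r / p\<close>, the right-hand side is at
  most the relative entropy of \<open>p\<close> with respect to \<open>r\<close>.
\<close>

lemma neg_ln_ge_square_deficit:
  fixes s :: real
  assumes "s > 0"
  shows "(max 0 (1 - s))\<^sup>2 / 2 \<le> s - 1 - ln s"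
proof (cases "s \<le> 1")
  case True
  define g where "g s = s - 1 - ln s - (1 - s)\<^sup>2 / 2" for s :: real
  have "g 1 \<le> g s"
  proof (rule DERIV_nonpos_imp_nonincreasing[OF True])
    fix x assume x: "s \<le> x" "x \<le> 1"
    have x0: "0 < x" using x assms by linarith
    have "(g has_real_derivative (1 - 1 / x + (1 - x))) (at x)"
      unfolding g_def using x0 by (auto intro!: derivative_eq_intros simp: field_simps)
    moreover have "1 - 1 / x + (1 - x) = - ((1 - x)\<^sup>2 / x)"
      using x0 by (simp add: field_simps power2_eq_square)
    moreover have "- ((1 - x)\<^sup>2 / x) \<le> 0" using x0 by simp
    ultimately show "\<exists>y. (g has_real_derivative y) (at x) \<and> y \<le> 0" by metis
  qed
  then show ?thesis using True by (simp add: g_def)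
next
  case False
  then show ?thesis using ln_le_minus_one[OF assms] by simp
qed

context group
begin

definition left_translate :: "'a \<Rightarrow> 'a pmf \<Rightarrow> 'a pmf" where
  "left_translate x p = map_pmf (\<lambda>z. x \<otimes> z) p"

lemma pmf_left_translate_inv:
  assumes "prob_measure_on G p" and x: "x \<in> carrier G" and y: "y \<in> carrier G"
  shows "pmf (left_translate (inv x) p) y = pmf p (x \<otimes> y)"
proof -
  have "pmf (left_translate (inv x) p) y = measure p ((\<lambda>z. inv x \<otimes> z) -` {y})"
    by (simp add: left_translate_def pmf_map)
  also have "\<dots> = measure p {x \<otimes> y}"
  proof (rule measure_prob_cong_0)
    fix z assume z: "z \<in> (\<lambda>z. inv x \<otimes> z) -` {y} - {x \<otimes> y}"
    show "pmf p z = 0"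
    proof (rule ccontr)
      assume "pmf p z \<noteq> 0"
      then have "z \<in> carrier G" using assms(1) by (auto simp: set_pmf_iff prob_measure_on_def)
      then show False using z x by (auto simp: m_assoc[symmetric])
    qed
  qed (use x y in \<open>auto simp: m_assoc[symmetric]\<close>)
  finally show ?thesis by (simp add: measure_pmf_single)
qed

text \<open>
  If \<open>X\<close> has law \<open>\<eta>\<close> and \<open>Y\<close> has law \<open>p\<close>, independently, then the difference of the two entropies is
  the mutual information of \<open>X\<close> and \<open>X \<otimes> Y\<close>: the average over \<open>x\<close> of the relative entropy
  of the law of \<open>x \<otimes> Y\<close> with respect to the law of \<open>X \<otimes> Y\<close>.  A single value \<open>x0\<close> of positive
  probability carries at most its share of this average.  Here both laws are translated back by \<open>x0\<close>.
\<close>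

lemma likelihood_deficit_le_entropy_increment:
  assumes \<eta>: "prob_measure_on G \<eta>" and p: "prob_measure_on G p"
    and fin: "finite_entropy p" "finite_entropy (convolution_pmf G \<eta> p)"
  defines "q \<equiv> convolution_pmf G \<eta> p"
  assumes x0: "x0 \<in> set_pmf \<eta>"
  shows "pmf \<eta> x0 * (\<integral>y. (max 0 (1 - pmf (left_translate (inv x0) q) y / pmf p y))\<^sup>2 \<partial>p)
     \<le> 2 * (shannon_entropy q - shannon_entropy p)"
proof -
  define J where "J = pair_pmf \<eta> p"
  have q_J: "q = map_pmf (\<lambda>(x, y). x \<otimes> y) J" by (simp add: q_def convolution_pmf_def J_def)
  have q_on: "prob_measure_on G q" using \<eta> p by (simp add: q_def prob_measure_on_convolution_pmf)
  have \<eta>_carrier: "x \<in> carrier G" if "x \<in> set_pmf \<eta>" for x using \<eta> that by (auto simp: prob_measure_on_def)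
  have p_carrier: "x \<in> carrier G" if "x \<in> set_pmf p" for x using p that by (auto simp: prob_measure_on_def)
  define s where "s = (\<lambda>(x, y). pmf q (x \<otimes> y) / pmf p y)"
  have s_eq: "s (x, y) = pmf (left_translate (inv x) q) y / pmf p y" if "x \<in> set_pmf \<eta>" "y \<in> set_pmf p" for x y
    using that by (simp add: s_def pmf_left_translate_inv[OF q_on] \<eta>_carrier p_carrier)
  have q_pos: "0 < pmf q (x \<otimes> y)" if "x \<in> set_pmf \<eta>" "y \<in> set_pmf p" for x y
    using that by (intro pmf_positive) (auto simp: q_J J_def)
  have p_pos: "0 < pmf p y" if "y \<in> set_pmf p" for y using that by (simp add: pmf_positive)
  have int_q: "integrable J (\<lambda>(x, y). ln (pmf q (x \<otimes> y)))"
    using fin(2) unfolding finite_entropy_def q_def[symmetric] q_J integrable_map_pmf_eq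
    by (simp add: case_prod_beta' q_J)
  have int_p: "integrable J (\<lambda>z. ln (pmf p (snd z)))"
  proof -
    have "integrable (map_pmf snd J) (\<lambda>y. ln (pmf p y))"
      using fin(1) by (simp add: J_def map_snd_pair_pmf finite_entropy_def)
    then show ?thesis by simp
  qed
  have E_q: "(\<integral>z. (case z of (x, y) \<Rightarrow> ln (pmf q (x \<otimes> y))) \<partial>J) = - shannon_entropy q"
    unfolding shannon_entropy_def by (subst (2) q_J) (simp add: case_prod_beta')
  have E_p: "(\<integral>z. ln (pmf p (snd z)) \<partial>J) = - shannon_entropy p"
    unfolding shannon_entropy_def J_def
    by (simp add: expectation_pair_pmf_snd[where f = "\<lambda>y. ln (pmf p y)"])
  \<comment> \<open>For each fixed first coordinate the ratio is that of two probability measures.\<close>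
  have s_nn: "(\<integral>\<^sup>+z. ennreal (s z) \<partial>J) \<le> 1"
  proof -
    have "(\<integral>\<^sup>+z. ennreal (s z) \<partial>J) = (\<integral>\<^sup>+x. \<integral>\<^sup>+y. ennreal (s (x, y)) \<partial>p \<partial>\<eta>)"
      unfolding J_def by (rule nn_integral_pair_pmf')
    also have "\<dots> \<le> (\<integral>\<^sup>+x. 1 \<partial>\<eta>)"
    proof (rule nn_integral_mono_AE, rule AE_pmfI)
      fix x assume x: "x \<in> set_pmf \<eta>"
      have "(\<integral>\<^sup>+y. ennreal (s (x, y)) \<partial>p) = (\<integral>\<^sup>+y. ennreal (pmf (left_translate (inv x) q) y / pmf p y) \<partial>p)"
        using s_eq[OF x] by (intro nn_integral_cong_AE) (auto simp: AE_measure_pmf_iff)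
      also have "\<dots> = ennreal (\<integral>y. pmf (left_translate (inv x) q) y / pmf p y \<partial>p)"
        by (intro nn_integral_eq_integral expectation_likelihood_ratio_le_one(1)) auto
      also have "\<dots> \<le> 1" using expectation_likelihood_ratio_le_one(2) by simp
      finally show "(\<integral>\<^sup>+y. ennreal (s (x, y)) \<partial>p) \<le> 1" .
    qed
    also have "\<dots> = 1" by simp
    finally show ?thesis .
  qed
  have s_nonneg: "0 \<le> s z" for z by (cases z) (simp add: s_def)
  have s_int: "integrable J s"
    using s_nn s_nonneg by (intro integrableI_bounded) (auto simp: less_top[symmetric] top_unique)
  have s_E: "(\<integral>z. s z \<partial>J) \<le> 1"
    using s_nn nn_integral_eq_integral[OF s_int] s_nonneg by simp
  \<comment> \<open>The term for \<open>x0\<close> is the restriction of the joint expectation to the first coordinate \<open>x0\<close>,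
    which is harmless since the integrand \<open>s - 1 - ln s\<close> is nonnegative.\<close>
  define k where "k y = (max 0 (1 - pmf (left_translate (inv x0) q) y / pmf p y))\<^sup>2" for y
  have k: "0 \<le> k y" "k y \<le> 1" for y
    by (auto simp: k_def power_le_one)
  have "pmf \<eta> x0 * (\<integral>y. k y \<partial>p) = (\<integral>x. indicator {x0} x * (\<integral>y. k y \<partial>p) \<partial>\<eta>)"
    by (simp add: measure_pmf_single)
  also have "\<dots> = (\<integral>x. (\<integral>y. indicator {x0} x * k y \<partial>p) \<partial>\<eta>)" by simp
  also have "\<dots> = (\<integral>z. (case z of (x, y) \<Rightarrow> indicator {x0} x * k y) \<partial>J)"
    unfolding J_def
    by (subst expectation_pair_pmf_bounded[where K = 1]) (use k in \<open>auto simp: indicator_def abs_le_iff intro: order_trans[of _ 0]\<close>)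
  also have "\<dots> \<le> (\<integral>z. 2 * (s z - 1 - ((case z of (x, y) \<Rightarrow> ln (pmf q (x \<otimes> y))) - ln (pmf p (snd z)))) \<partial>J)"
  proof (rule integral_mono_AE)
    show "integrable J (\<lambda>(x, y). indicator {x0} x * k y)"
      using k by (intro measure_pmf.integrable_const_bound[where B = 1]) (auto simp: indicator_def)
    show "integrable J (\<lambda>z. 2 * (s z - 1 - ((case z of (x, y) \<Rightarrow> ln (pmf q (x \<otimes> y))) - ln (pmf p (snd z)))))"
      using s_int int_q int_p by simp
    show "AE z in J. (case z of (x, y) \<Rightarrow> indicator {x0} x * k y)
        \<le> 2 * (s z - 1 - ((case z of (x, y) \<Rightarrow> ln (pmf q (x \<otimes> y))) - ln (pmf p (snd z))))"
    proof (rule AE_pmfI)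
      fix z assume "z \<in> set_pmf J"
      then obtain x y where z: "z = (x, y)" and x: "x \<in> set_pmf \<eta>" and y: "y \<in> set_pmf p"
        by (auto simp: J_def)
      have pos: "0 < s (x, y)" using q_pos[OF x y] p_pos[OF y] by (simp add: s_def)
      have ln_s: "ln (s (x, y)) = ln (pmf q (x \<otimes> y)) - ln (pmf p y)"
        using q_pos[OF x y] p_pos[OF y] by (simp add: s_def ln_div)
      have "indicator {x0} x * k y \<le> (max 0 (1 - s (x, y)))\<^sup>2"
        using s_eq[OF x y] by (auto simp: indicator_def k_def)
      also have "\<dots> \<le> 2 * (s (x, y) - 1 - ln (s (x, y)))"
        using neg_ln_ge_square_deficit[OF pos] by simp
      finally show "(case z of (x, y) \<Rightarrow> indicator {x0} x * k y)
        \<le> 2 * (s z - 1 - ((case z of (x, y) \<Rightarrow> ln (pmf q (x \<otimes> y))) - ln (pmf p (snd z))))"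
        by (simp add: z ln_s)
    qed
  qed
  also have "\<dots> = 2 * ((\<integral>z. s z \<partial>J) - 1 + shannon_entropy q - shannon_entropy p)"
    using s_int int_q int_p E_q E_p by simp
  also have "\<dots> \<le> 2 * (shannon_entropy q - shannon_entropy p)" using s_E by simp
  finally show ?thesis by (simp add: k_def)
qed

end

section \<open>Small entropy increments force the Liouville property\<close>

context group
begin

lemma harmonic_expectation:
  assumes \<eta>: "prob_measure_on G \<eta>" and h: "harmonic G \<eta> h"
    and bd: "\<And>x. x \<in> carrier G \<Longrightarrow> \<bar>h x\<bar> \<le> K" and x: "x \<in> carrier G"
  shows "(\<integral>z. h (x \<otimes> z) \<partial>convolution_power G \<eta> n) = h x"
  using x
proof (induction n arbitrary: x)
  case (Suc n)
  have one_step: "(\<integral>z. h (y \<otimes> z) \<partial>\<eta>) = h y" if y: "y \<in> carrier G" for y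
  proof -
    let ?f = "\<lambda>z. h (y \<otimes> z) * pmf \<eta> z"
    have "Infinite_Set_Sum.abs_summable_on ?f (carrier G)"
    proof (rule abs_summable_on_comparison_test)
      show "Infinite_Set_Sum.abs_summable_on (\<lambda>z. K * pmf \<eta> z) (carrier G)"
        by (intro abs_summable_on_cmult_right) (rule pmf_abs_summable)
      show "norm (?f z) \<le> norm (K * pmf \<eta> z)" if "z \<in> carrier G" for z
        using bd[of "y \<otimes> z"] that y by (auto simp: abs_mult intro!: mult_right_mono)
    qed
    then have "infsetsum ?f (carrier G) = infsum ?f (carrier G)" by (rule infsetsum_infsum)
    also have "\<dots> = h y" using h y by (intro infsumI) (simp add: harmonic_def)
    finally have eq: "infsetsum ?f (carrier G) = h y" .
    have "(\<integral>z. h (y \<otimes> z) \<partial>\<eta>) = infsetsum (\<lambda>z. pmf \<eta> z * h (y \<otimes> z)) UNIV"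
      by (rule pmf_expectation_eq_infsetsum)
    also have "\<dots> = infsetsum ?f (carrier G)"
      using \<eta> by (intro infsetsum_cong_neutral) (auto simp: prob_measure_on_def set_pmf_iff)
    finally show ?thesis using eq by simp
  qed
  define p where "p = convolution_power G \<eta> n"
  have p: "prob_measure_on G p" using \<eta> by (simp add: p_def prob_measure_on_convolution_power)
  have "(\<integral>z. h (x \<otimes> z) \<partial>convolution_power G \<eta> (Suc n))
      = (\<integral>z. (case z of (y, w) \<Rightarrow> h (x \<otimes> (y \<otimes> w))) \<partial>pair_pmf p \<eta>)"
    by (simp add: convolution_pmf_def p_def case_prod_beta')
  also have "\<dots> = (\<integral>y. (\<integral>w. h (x \<otimes> (y \<otimes> w)) \<partial>\<eta>) \<partial>p)"
    using bd \<eta> p Suc.prems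
    by (subst expectation_pair_pmf_bounded[where K = K]) (auto simp: prob_measure_on_def subset_iff)
  also have "\<dots> = (\<integral>y. h (x \<otimes> y) \<partial>p)"
  proof (rule integral_cong_AE)
    show "AE y in measure_pmf p. (\<integral>w. h (x \<otimes> (y \<otimes> w)) \<partial>\<eta>) = h (x \<otimes> y)"
    proof (rule AE_pmfI)
      fix y assume "y \<in> set_pmf p"
      then have y: "y \<in> carrier G" using p by (auto simp: prob_measure_on_def)
      have "(\<integral>w. h (x \<otimes> (y \<otimes> w)) \<partial>\<eta>) = (\<integral>w. h ((x \<otimes> y) \<otimes> w) \<partial>\<eta>)"
        using \<eta> y Suc.prems
        by (intro integral_cong_AE) (auto simp: AE_measure_pmf_iff prob_measure_on_def m_assoc subset_iff)
      then show "(\<integral>w. h (x \<otimes> (y \<otimes> w)) \<partial>\<eta>) = h (x \<otimes> y)"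
        using one_step y Suc.prems by simp
    qed
  qed auto
  also have "\<dots> = h x" using Suc by (simp add: p_def)
  finally show ?case .
qed simp

text \<open>
  The value \<open>h (g \<otimes> x0)\<close> is the mean of \<open>h\<close> over \<open>n\<close> further steps from \<open>g \<otimes> x0\<close>, and \<open>h g\<close> is the mean
  over \<open>n + 1\<close> steps from \<open>g\<close>.  The two laws of the endpoint are close as soon as the first step hardly
  influences the position after \<open>n + 1\<close> steps, that is, if the entropy increment is small.
\<close>

lemma abs_harmonic_diff_le:
  fixes n :: nat
  assumes \<eta>: "prob_measure_on G \<eta>" and h: "harmonic G \<eta> h"
    and bd: "\<And>x. x \<in> carrier G \<Longrightarrow> \<bar>h x\<bar> \<le> K"
    and fin: "\<And>n. finite_entropy (convolution_power G \<eta> n)"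
    and g: "g \<in> carrier G" and x0: "x0 \<in> set_pmf \<eta>"
  defines "I \<equiv> shannon_entropy (convolution_power G \<eta> (Suc n)) - shannon_entropy (convolution_power G \<eta> n)"
  shows "\<bar>h (g \<otimes> x0) - h g\<bar> \<le> 2 * K * sqrt (2 * I / pmf \<eta> x0)"
proof -
  define p where "p = convolution_power G \<eta> n"
  define q where "q = convolution_pmf G \<eta> p"
  define r where "r = left_translate (inv x0) q"
  define d where "d y = max 0 (1 - pmf r y / pmf p y)" for y
  have p: "prob_measure_on G p" using \<eta> by (simp add: p_def prob_measure_on_convolution_power)
  have q_power: "q = convolution_power G \<eta> (Suc n)"
    using convolution_power_Suc_left[OF \<eta>] by (simp add: q_def p_def)
  have x0c: "x0 \<in> carrier G" using x0 \<eta> by (auto simp: prob_measure_on_def)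
  have K: "0 \<le> K" using bd[OF one_closed] by linarith
  have d: "0 \<le> d y" "d y \<le> 1" for y by (auto simp: d_def)
  have d_int: "integrable (measure_pmf p) d"
    using d by (intro measure_pmf.integrable_const_bound[where B = 1]) auto
  have d2_int: "integrable (measure_pmf p) (\<lambda>y. (d y)\<^sup>2)"
    using d by (intro measure_pmf.integrable_const_bound[where B = 1]) (auto simp: power_le_one)
  define m where "m = (\<integral>y. d y \<partial>p)"
  have \<eta>_pos: "0 < pmf \<eta> x0" using x0 by (simp add: pmf_positive)
  have m_le: "m \<le> sqrt (2 * I / pmf \<eta> x0)"
  proof -
    \<comment> \<open>The variance of \<open>d\<close> is nonnegative.\<close>
    have "0 \<le> (\<integral>y. (d y - m)\<^sup>2 \<partial>p)" by (intro integral_nonneg_AE) simp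
    also have "\<dots> = (\<integral>y. (d y)\<^sup>2 - 2 * m * d y + m\<^sup>2 \<partial>p)"
      by (simp add: power2_diff algebra_simps)
    also have "\<dots> = (\<integral>y. (d y)\<^sup>2 \<partial>p) - m\<^sup>2"
      using d_int d2_int by (simp add: m_def[symmetric] power2_eq_square)
    finally have "m\<^sup>2 \<le> (\<integral>y. (d y)\<^sup>2 \<partial>p)" by simp
    also have "\<dots> \<le> 2 * I / pmf \<eta> x0"
    proof -
      have "pmf \<eta> x0 * (\<integral>y. (d y)\<^sup>2 \<partial>p) \<le> 2 * (shannon_entropy q - shannon_entropy p)"
        unfolding d_def r_def q_def
        by (rule likelihood_deficit_le_entropy_increment[OF \<eta> p _ _ x0])
          (use fin[of n] fin[of "Suc n"] in \<open>simp_all only: p_def q_power[unfolded q_def p_def]\<close>)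
      then show ?thesis using \<eta>_pos q_power
        by (simp add: I_def p_def field_simps)
    qed
    finally show ?thesis by (rule real_le_rsqrt)
  qed
  have Ep: "(\<integral>y. h (g \<otimes> (x0 \<otimes> y)) \<partial>p) = h (g \<otimes> x0)"
  proof -
    have "(\<integral>y. h (g \<otimes> (x0 \<otimes> y)) \<partial>p) = (\<integral>y. h ((g \<otimes> x0) \<otimes> y) \<partial>p)"
      using p g x0c by (intro integral_cong_AE) (auto simp: AE_measure_pmf_iff prob_measure_on_def m_assoc subset_iff)
    then show ?thesis using harmonic_expectation[OF \<eta> h bd, of "g \<otimes> x0" n] g x0c by (simp add: p_def)
  qed
  have q: "prob_measure_on G q" using \<eta> p by (simp add: q_def prob_measure_on_convolution_pmf)
  have Er: "(\<integral>y. h (g \<otimes> (x0 \<otimes> y)) \<partial>r) = h g"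
  proof -
    have "(\<integral>y. h (g \<otimes> (x0 \<otimes> y)) \<partial>r) = (\<integral>z. h (g \<otimes> (x0 \<otimes> (inv x0 \<otimes> z))) \<partial>q)"
      by (simp add: r_def left_translate_def)
    also have "\<dots> = (\<integral>z. h (g \<otimes> z) \<partial>q)"
      using q x0c by (intro integral_cong_AE) (auto simp: AE_measure_pmf_iff prob_measure_on_def m_assoc[symmetric] subset_iff)
    also have "\<dots> = h g" using harmonic_expectation[OF \<eta> h bd g, of "Suc n"] by (simp add: q_power)
    finally show ?thesis .
  qed
  have r: "prob_measure_on G r" using q x0c by (auto simp: r_def left_translate_def prob_measure_on_def)
  \<comment> \<open>The shifts \<open>K + h\<close> and \<open>K - h\<close> take values between 0 and \<open>2 K\<close>; they give one inequality each.\<close>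
  have one_sided: "\<sigma> * (h (g \<otimes> x0) - h g) \<le> 2 * K * m" if \<sigma>: "\<sigma> = 1 \<or> \<sigma> = - 1" for \<sigma> :: real
  proof -
    define w where "w y = (if y \<in> carrier G then K + \<sigma> * h (g \<otimes> (x0 \<otimes> y)) else 0)" for y
    have w: "0 \<le> w y" "w y \<le> 2 * K" for y
      using bd[of "g \<otimes> (x0 \<otimes> y)"] g x0c \<sigma> K by (auto simp: w_def abs_le_iff)
    have E: "(\<integral>y. w y \<partial>s) = K + \<sigma> * (\<integral>y. h (g \<otimes> (x0 \<otimes> y)) \<partial>s)" if s: "prob_measure_on G s" for s
    proof -
      have "integrable (measure_pmf s) (\<lambda>y. h (g \<otimes> (x0 \<otimes> y)))"
        using s bd g x0c
        by (intro measure_pmf.integrable_const_bound[where B = K])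
          (auto simp: AE_measure_pmf_iff prob_measure_on_def subset_iff)
      moreover have "(\<integral>y. w y \<partial>s) = (\<integral>y. K + \<sigma> * h (g \<otimes> (x0 \<otimes> y)) \<partial>s)"
        using s by (intro integral_cong_AE) (auto simp: AE_measure_pmf_iff prob_measure_on_def w_def subset_iff)
      ultimately show ?thesis by simp
    qed
    have "(\<integral>y. w y \<partial>p) - (\<integral>y. w y \<partial>r) \<le> 2 * K * (\<integral>y. max 0 (1 - pmf r y / pmf p y) \<partial>p)"
      by (rule expectation_diff_le_likelihood_deficit) (rule w)+
    then show ?thesis using E[OF p] E[OF r] Ep Er by (simp add: m_def d_def algebra_simps)
  qed
  have "\<bar>h (g \<otimes> x0) - h g\<bar> \<le> 2 * K * m" using one_sided[of 1] one_sided[of "- 1"] by (auto simp: abs_le_iff)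
  also have "\<dots> \<le> 2 * K * sqrt (2 * I / pmf \<eta> x0)" using K m_le by (intro mult_left_mono) auto
  finally show ?thesis .
qed

text \<open>
  A single small increment at any time suffices for each precision, because the estimate for a harmonic
  function holds at every time.
\<close>

lemma liouville_if_small_entropy_increments:
  assumes \<eta>: "prob_measure_on G \<eta>" and gen: "generating_support G \<eta>"
    and fin: "\<And>n. finite_entropy (convolution_power G \<eta> n)"
    and small: "\<And>\<epsilon>. 0 < \<epsilon> \<Longrightarrow> \<exists>n. shannon_entropy (convolution_power G \<eta> (Suc n))
                                 - shannon_entropy (convolution_power G \<eta> n) \<le> \<epsilon>"
  shows "liouville_property G \<eta>"
  unfolding liouville_property_def
proof (intro allI impI)
  fix h assume "harmonic G \<eta> h \<and> bounded (h ` carrier G)"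
  then obtain K where h: "harmonic G \<eta> h" and bd: "\<And>x. x \<in> carrier G \<Longrightarrow> \<bar>h x\<bar> \<le> K"
    unfolding bounded_iff by auto
  have K: "0 \<le> K" using bd[OF one_closed] by linarith
  have step: "h (g \<otimes> x) = h g" if g: "g \<in> carrier G" and x: "x \<in> set_pmf \<eta>" for g x
  proof (rule ccontr)
    assume "h (g \<otimes> x) \<noteq> h g"
    then have D: "0 < \<bar>h (g \<otimes> x) - h g\<bar>" (is "0 < ?D") by simp
    have \<eta>_pos: "0 < pmf \<eta> x" using x by (simp add: pmf_positive)
    define \<epsilon> where "\<epsilon> = pmf \<eta> x * (?D / (4 * (K + 1)))\<^sup>2 / 2"
    have "0 < \<epsilon>" using D \<eta>_pos K by (simp add: \<epsilon>_def)
    then obtain n where n: "shannon_entropy (convolution_power G \<eta> (Suc n))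
                                 - shannon_entropy (convolution_power G \<eta> n) \<le> \<epsilon>" (is "?I \<le> \<epsilon>")
      using small by blast
    have "?D \<le> 2 * K * sqrt (2 * ?I / pmf \<eta> x)"
      by (rule abs_harmonic_diff_le[OF \<eta> h bd fin g x])
    also have "\<dots> \<le> 2 * K * sqrt (2 * \<epsilon> / pmf \<eta> x)"
      using n \<eta>_pos K by (intro mult_left_mono real_sqrt_le_mono divide_right_mono) auto
    also have "2 * \<epsilon> / pmf \<eta> x = (?D / (4 * (K + 1)))\<^sup>2" using \<eta>_pos by (simp add: \<epsilon>_def)
    also have "sqrt ((?D / (4 * (K + 1)))\<^sup>2) = ?D / (4 * (K + 1))"
      using K by (intro real_sqrt_unique) auto
    also have "2 * K * (?D / (4 * (K + 1))) = ?D * (K / (2 * (K + 1)))"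
      using K by (simp add: field_simps)
    also have "\<dots> < ?D * 1" using K D by (intro mult_strict_left_mono) (auto simp: field_simps)
    finally show False by simp
  qed
  have "h (g \<otimes> x) = h g" if "x \<in> generate G (set_pmf \<eta>)" "g \<in> carrier G" for g x
    using that
  proof (induction arbitrary: g)
    case (inv x)
    then have "x \<in> carrier G" using \<eta> by (auto simp: prob_measure_on_def)
    then show ?case using step[of "g \<otimes> inv x" x] inv by (simp add: m_assoc)
  next
    case (eng x y)
    then have "x \<in> carrier G" "y \<in> carrier G"
      using gen by (auto simp: generating_support_def)
    then show ?case using eng by (simp add: m_assoc[symmetric])
  qed (use step in auto)
  then have "h x = h \<one>" if "x \<in> carrier G" for x
    using that gen unfolding generating_support_def by (metis l_one one_closed)
  then show "h constant_on carrier G" unfolding constant_on_def by blast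
qed

end

section \<open>Entropy of a measure that is concentrated on a small set\<close>

context word_metric
begin

lemma integrable_word_length_square:
  assumes "prob_measure_on G p" and "(\<lambda>g. (real (wl g))\<^sup>2 * pmf p g) summable_on carrier G"
  shows "integrable (measure_pmf p) (\<lambda>g. (real (wl g))\<^sup>2)"
proof -
  let ?f = "\<lambda>g. pmf p g * (real (wl g))\<^sup>2"
  have "(\<lambda>g. norm (?f g)) summable_on carrier G"
    using assms(2) by (simp add: mult.commute abs_mult)
  then have "Infinite_Set_Sum.abs_summable_on ?f (carrier G)" using abs_summable_equivalent by blast
  then have "Infinite_Set_Sum.abs_summable_on ?f UNIV"
    using assms(1)
    by (subst abs_summable_on_cong_neutral[of _ "carrier G" _ ?f]) (auto simp: prob_measure_on_def set_pmf_iff)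
  then show ?thesis
    unfolding abs_summable_on_def measure_pmf_eq_density by (subst integrable_density) auto
qed

lemma word_length_square_mult_le:
  assumes "x \<in> carrier G" and "y \<in> carrier G"
  shows "(real (wl (x \<otimes> y)))\<^sup>2 \<le> 2 * (real (wl x))\<^sup>2 + 2 * (real (wl y))\<^sup>2"
proof -
  have "(real (wl (x \<otimes> y)))\<^sup>2 \<le> (real (wl x) + real (wl y))\<^sup>2"
    using word_length_mult_le[OF assms] by (intro power_mono) auto
  also have "\<dots> \<le> 2 * (real (wl x))\<^sup>2 + 2 * (real (wl y))\<^sup>2"
    using sum_squares_ge_zero[of "real (wl x) - real (wl y)" 0] by (simp add: power2_eq_square algebra_simps)
  finally show ?thesis .
qed

lemma second_moment_convolution:
  assumes p: "prob_measure_on G p" "integrable (measure_pmf p) (\<lambda>g. (real (wl g))\<^sup>2)"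
    and q: "prob_measure_on G q" "integrable (measure_pmf q) (\<lambda>g. (real (wl g))\<^sup>2)"
  shows "integrable (measure_pmf (convolution_pmf G p q)) (\<lambda>g. (real (wl g))\<^sup>2)"
    and "(\<integral>g. (real (wl g))\<^sup>2 \<partial>convolution_pmf G p q)
       \<le> 2 * (\<integral>g. (real (wl g))\<^sup>2 \<partial>p) + 2 * (\<integral>g. (real (wl g))\<^sup>2 \<partial>q)"
proof -
  let ?J = "pair_pmf p q" and ?s = "\<lambda>g. (real (wl g))\<^sup>2"
  let ?b = "\<lambda>z. 2 * ?s (fst z) + 2 * ?s (snd z)"
  have "integrable (map_pmf fst ?J) ?s" "integrable (map_pmf snd ?J) ?s"
    using p q by (simp_all add: map_fst_pair_pmf map_snd_pair_pmf)
  then have int: "integrable ?J (\<lambda>z. ?s (fst z))" "integrable ?J (\<lambda>z. ?s (snd z))" by auto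
  then have b: "integrable ?J ?b" by simp
  have le: "AE z in ?J. ?s (case z of (x, y) \<Rightarrow> x \<otimes> y) \<le> ?b z"
    using p(1) q(1) word_length_square_mult_le
    by (auto simp: AE_measure_pmf_iff prob_measure_on_def subset_iff)
  have J: "integrable ?J (\<lambda>z. ?s (case z of (x, y) \<Rightarrow> x \<otimes> y))"
  proof (rule Bochner_Integration.integrable_bound[OF b])
    show "AE z in ?J. norm (?s (case z of (x, y) \<Rightarrow> x \<otimes> y)) \<le> norm (?b z)"
      using le by eventually_elim simp
  qed simp
  then show "integrable (measure_pmf (convolution_pmf G p q)) ?s"
    unfolding convolution_pmf_def integrable_map_pmf_eq .
  have "(\<integral>g. ?s g \<partial>convolution_pmf G p q) = (\<integral>z. ?s (case z of (x, y) \<Rightarrow> x \<otimes> y) \<partial>?J)"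
    by (simp add: convolution_pmf_def)
  also have "\<dots> \<le> (\<integral>z. ?b z \<partial>?J)" by (rule integral_mono_AE[OF J b le])
  also have "\<dots> = 2 * (\<integral>g. ?s g \<partial>p) + 2 * (\<integral>g. ?s g \<partial>q)"
    using int expectation_pair_pmf_fst[of p q ?s] expectation_pair_pmf_snd[of p q ?s] by simp
  finally show "(\<integral>g. ?s g \<partial>convolution_pmf G p q) \<le> 2 * (\<integral>g. ?s g \<partial>p) + 2 * (\<integral>g. ?s g \<partial>q)" .
qed

lemma second_moment_convolution_power:
  assumes "prob_measure_on G p" "integrable (measure_pmf p) (\<lambda>g. (real (wl g))\<^sup>2)"
  shows "integrable (measure_pmf (convolution_power G p n)) (\<lambda>g. (real (wl g))\<^sup>2)"
proof (induction n)
  case 0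
  then show ?case by (simp add: integrable_measure_pmf_finite)
next
  case (Suc n)
  then show ?case using assms by (simp add: second_moment_convolution prob_measure_on_convolution_power)
qed

text \<open>
  The walk has at most quadratic second moment because \<open>(a + b)\<^sup>2 \<le> 2 a\<^sup>2 + 2 b\<^sup>2\<close>, which at
  each doubling of the time loses nothing against the factor 4.
\<close>

lemma second_moment_dyadic:
  assumes "prob_measure_on G p" "integrable (measure_pmf p) (\<lambda>g. (real (wl g))\<^sup>2)"
  shows "(\<integral>g. (real (wl g))\<^sup>2 \<partial>convolution_power G p (2 ^ k)) \<le> (2 ^ k)\<^sup>2 * (\<integral>g. (real (wl g))\<^sup>2 \<partial>p)"
proof (induction k)
  case 0
  then show ?case using assms(1) by (simp add: convolution_pmf_one_left)
next
  case (Suc k)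
  let ?q = "convolution_power G p (2 ^ k)"
  have "convolution_power G p (2 ^ Suc k) = convolution_pmf G ?q ?q"
    using convolution_power_add[OF assms(1), of "2 ^ k" "2 ^ k"] by (simp add: mult_2)
  then have "(\<integral>g. (real (wl g))\<^sup>2 \<partial>convolution_power G p (2 ^ Suc k))
      \<le> 2 * (\<integral>g. (real (wl g))\<^sup>2 \<partial>?q) + 2 * (\<integral>g. (real (wl g))\<^sup>2 \<partial>?q)"
    using second_moment_convolution(2)[of ?q ?q] assms
    by (simp only: second_moment_convolution_power prob_measure_on_convolution_power)
  then show ?case using Suc by (simp add: power_mult_distrib)
qed

text \<open>
  The reference measure is the even mixture of the uniform measure on \<open>U\<close> and of the exponential reference
  measure.  On \<open>U\<close> it costs \<open>ln (card U)\<close>; outside \<open>U\<close> it costs a multiple of the word length, whose mean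
  there is small by the second moment bound, since little mass lies outside.
\<close>

lemma entropy_bound_of_concentration:
  "\<exists>a\<ge>0. \<forall>(p :: 'a pmf) (U :: 'a set) (t :: real) (M :: real) (\<delta> :: real). prob_measure_on G p \<longrightarrow> integrable (measure_pmf p) (\<lambda>g. (real (wl g))\<^sup>2) \<longrightarrow>
     finite U \<longrightarrow> U \<noteq> {} \<longrightarrow> 0 < t \<longrightarrow> 0 < \<delta> \<longrightarrow>
     (\<integral>g. (real (wl g))\<^sup>2 \<partial>p) \<le> t\<^sup>2 * M \<longrightarrow> measure p (- U) \<le> \<delta>\<^sup>2 \<longrightarrow>
     finite_entropy p \<and> shannon_entropy p \<le> ln (real (card U)) + 2 * ln 2 + a * (t * \<delta> * (M + 1) / 2)"
proof -
  obtain q a where a: "0 \<le> a" and q: "\<And>g. g \<in> carrier G \<Longrightarrow> 0 < pmf q g"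
    "\<And>g. g \<in> carrier G \<Longrightarrow> - ln (pmf q g) \<le> ln 2 + a * real (wl g)"
    using ex_exponential_reference_pmf by blast
  show ?thesis
  proof (intro exI[of _ a] conjI allI impI)
    fix p :: "'a pmf" and U :: "'a set" and t M \<delta> :: real
    assume p: "prob_measure_on G p" "integrable (measure_pmf p) (\<lambda>g. (real (wl g))\<^sup>2)"
      and U: "finite U" "U \<noteq> {}" and t: "0 < t" and \<delta>: "0 < \<delta>"
      and M: "(\<integral>g. (real (wl g))\<^sup>2 \<partial>p) \<le> t\<^sup>2 * M" and out: "measure p (- U) \<le> \<delta>\<^sup>2"
    define r where "r = bind_pmf (bernoulli_pmf (1/2)) (\<lambda>b. if b then pmf_of_set U else q)"
    have r: "pmf r x = (1/2) * (indicator U x / card U) + (1/2) * pmf q x" for x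
      using U by (simp add: r_def pmf_bind)
    define b where "b x = ln (real (card U)) + 2 * ln 2 +
      a * ((\<delta> / (2 * t)) * (real (wl x))\<^sup>2 + (t / (2 * \<delta>)) * indicator (- U) x)" for x
    have card_U: "1 \<le> real (card U)" using U by (simp add: Suc_leI card_gt_0_iff)
    have r_pos: "0 < pmf r x" if "x \<in> carrier G" for x
      unfolding r using q(1)[OF that] by (intro add_nonneg_pos) auto
    have b_ge: "- ln (pmf r x) \<le> b x" if x: "x \<in> carrier G" for x
    proof (cases "x \<in> U")
      case True
      have "1 / (2 * card U) \<le> pmf r x" using True by (simp add: r)
      then have "ln (1 / (2 * card U)) \<le> ln (pmf r x)"
        using card_U r_pos[OF x] by (subst ln_le_cancel_iff) auto
      then have "- ln (pmf r x) \<le> ln (real (card U)) + ln 2" using card_U by (simp add: ln_div ln_mult)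
      moreover have "0 \<le> a * ((\<delta> / (2 * t)) * (real (wl x))\<^sup>2)" using a t \<delta> by simp
      moreover have "0 \<le> ln (2::real)" by simp
      moreover have "b x = ln (real (card U)) + 2 * ln 2 + a * ((\<delta> / (2 * t)) * (real (wl x))\<^sup>2)"
        using True by (simp add: b_def)
      ultimately show ?thesis by linarith
    next
      case False
      have "ln (pmf q x / 2) \<le> ln (pmf r x)"
        using q(1)[OF x] r_pos[OF x] by (subst ln_le_cancel_iff) (auto simp: r)
      then have 1: "- ln (pmf r x) \<le> 2 * ln 2 + a * real (wl x)"
        using q(1,2)[OF x] by (simp add: ln_div)
      \<comment> \<open>Weighted arithmetic-geometric mean inequality, with the weight that balances the second moment
        against the mass outside \<open>U\<close>.\<close>
      have "0 \<le> (\<delta> / (2 * t)) * (real (wl x) - t / \<delta>)\<^sup>2" using t \<delta> by simp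
      also have "\<dots> = (\<delta> / (2 * t)) * (real (wl x))\<^sup>2 + t / (2 * \<delta>) - real (wl x)"
        using t \<delta> by (simp add: field_simps power2_eq_square)
      finally have "a * real (wl x) \<le> a * ((\<delta> / (2 * t)) * (real (wl x))\<^sup>2 + t / (2 * \<delta>))"
        using a by (intro mult_left_mono) auto
      moreover have "0 \<le> ln (real (card U))" using card_U by simp
      ultimately show ?thesis using 1 False unfolding b_def by simp
    qed
    have ind_int: "integrable p (indicat_real (- U))"
      by (intro measure_pmf.integrable_const_bound[where B = 1]) (auto simp: indicator_def)
    have b_int: "integrable p b" unfolding b_def using p(2) ind_int by simp
    have supp: "x \<in> carrier G" if "x \<in> set_pmf p" for x using p(1) that by (auto simp: prob_measure_on_def)
    note gibbs = gibbs_inequality[of p r b, OF r_pos[OF supp] b_ge[OF supp] b_int]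
    show "finite_entropy p" by (rule gibbs)
    have "shannon_entropy p \<le> (\<integral>x. b x \<partial>p)" by (rule gibbs)
    also have "\<dots> = ln (real (card U)) + 2 * ln 2 +
        a * ((\<delta> / (2 * t)) * (\<integral>x. (real (wl x))\<^sup>2 \<partial>p) + (t / (2 * \<delta>)) * measure p (- U))"
      unfolding b_def using p(2) ind_int by simp
    also have "\<dots> \<le> ln (real (card U)) + 2 * ln 2 + a * ((\<delta> / (2 * t)) * (t\<^sup>2 * M) + (t / (2 * \<delta>)) * \<delta>\<^sup>2)"
      using a t \<delta> M out by (intro add_left_mono mult_left_mono add_mono) auto
    also have "(\<delta> / (2 * t)) * (t\<^sup>2 * M) + (t / (2 * \<delta>)) * \<delta>\<^sup>2 = t * \<delta> * (M + 1) / 2"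
      using t \<delta> by (simp add: field_simps power2_eq_square)
    finally show "shannon_entropy p \<le> ln (real (card U)) + 2 * ln 2 + a * (t * \<delta> * (M + 1) / 2)" .
  qed (rule a)
qed

text \<open>
  Concentration on \<open>exp (o (t))\<close> elements at the time \<open>t = 2 ^ k\<close> makes the entropy at time \<open>t\<close> of order
  \<open>o (t)\<close>.  It is the sum of \<open>t\<close> increments, so one of them is small.
\<close>

theorem liouville_if_concentrated:
  assumes \<eta>: "prob_measure_on G \<eta>" and gen: "generating_support G \<eta>"
    and moment: "integrable (measure_pmf \<eta>) (\<lambda>g. (real (wl g))\<^sup>2)"
    and conc: "\<And>\<delta>. 0 < (\<delta> :: real) \<Longrightarrow> \<exists>k (U :: 'a set). finite U \<and> U \<noteq> {} \<and> 1 \<le> \<delta> * 2 ^ k \<and> ln (real (card U)) \<le> \<delta> * 2 ^ k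
        \<and> measure (convolution_power G \<eta> (2 ^ k)) (- U) \<le> \<delta>\<^sup>2"
  shows "liouville_property G \<eta>"
proof (rule liouville_if_small_entropy_increments[OF \<eta> gen])
  define M where "M = (\<integral>g. (real (wl g))\<^sup>2 \<partial>\<eta>)"
  have M: "0 \<le> M" by (simp add: M_def integral_nonneg_AE)
  obtain a where a: "0 \<le> a" and ent: "\<And>(p :: 'a pmf) (U :: 'a set) (t :: real) (M :: real) (\<delta> :: real). prob_measure_on G p \<Longrightarrow>
      integrable (measure_pmf p) (\<lambda>g. (real (wl g))\<^sup>2) \<Longrightarrow>
     finite U \<Longrightarrow> U \<noteq> {} \<Longrightarrow> 0 < t \<Longrightarrow> 0 < \<delta> \<Longrightarrow>
     (\<integral>g. (real (wl g))\<^sup>2 \<partial>p) \<le> t\<^sup>2 * M \<Longrightarrow> measure p (- U) \<le> \<delta>\<^sup>2 \<Longrightarrow>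
     finite_entropy p \<and> shannon_entropy p \<le> ln (real (card U)) + 2 * ln 2 + a * (t * \<delta> * (M + 1) / 2)"
    using entropy_bound_of_concentration by blast
  let ?p = "convolution_power G \<eta>"
  have p: "prob_measure_on G (?p n)" "integrable (measure_pmf (?p n)) (\<lambda>g. (real (wl g))\<^sup>2)" for n
    using \<eta> moment by (simp_all add: prob_measure_on_convolution_power second_moment_convolution_power)
  show "finite_entropy (?p n)" for n
    using ent[OF p[of n], where U = "{\<one>}" and t = 1 and \<delta> = 1 and M = "\<integral>g. (real (wl g))\<^sup>2 \<partial>?p n"]
    by simp
  fix \<epsilon> :: real assume \<epsilon>: "0 < \<epsilon>"
  define C where "C = 1 + 2 * ln 2 + a * ((M + 1) / 2)"
  have "0 \<le> a * ((M + 1) / 2)" "0 \<le> ln (2::real)" using a M by auto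
  then have C: "0 < C" unfolding C_def by linarith
  have "0 < \<epsilon> / C" using \<epsilon> C by simp
  from conc[OF this] obtain k U where U: "finite U" "U \<noteq> {}" and k: "1 \<le> \<epsilon> / C * 2 ^ k"
    and card: "ln (real (card U)) \<le> \<epsilon> / C * 2 ^ k" and out: "measure (?p (2 ^ k)) (- U) \<le> (\<epsilon> / C)\<^sup>2" by blast
  have "shannon_entropy (?p (2 ^ k)) \<le> ln (real (card U)) + 2 * ln 2 + a * (2 ^ k * (\<epsilon> / C) * (M + 1) / 2)"
    using ent[OF p U _ \<open>0 < \<epsilon> / C\<close> _ out, where t = "2 ^ k" and M = M] second_moment_dyadic[OF \<eta> moment, of k]
    by (simp add: M_def)
  also have "\<dots> \<le> \<epsilon> / C * 2 ^ k + 2 * ln 2 * (\<epsilon> / C * 2 ^ k) + a * (2 ^ k * (\<epsilon> / C) * (M + 1) / 2)"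
  proof -
    have "2 * ln 2 * 1 \<le> 2 * ln 2 * (\<epsilon> / C * 2 ^ k)" using k by (intro mult_left_mono) auto
    then show ?thesis using card by simp
  qed
  also have "\<dots> = \<epsilon> / C * 2 ^ k * C"
  proof -
    have "c * 2 ^ k + 2 * ln 2 * (c * 2 ^ k) + a * (2 ^ k * c * (M + 1) / 2) = c * 2 ^ k * C" for c :: real
      by (simp add: C_def field_simps)
    then show ?thesis .
  qed
  also have "\<dots> = 2 ^ k * \<epsilon>" using C by simp
  finally have total: "shannon_entropy (?p (2 ^ k)) \<le> 2 ^ k * \<epsilon>" .
  show "\<exists>n. shannon_entropy (?p (Suc n)) - shannon_entropy (?p n) \<le> \<epsilon>"
  proof (rule ccontr)
    assume "\<nexists>n. shannon_entropy (?p (Suc n)) - shannon_entropy (?p n) \<le> \<epsilon>"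
    then have "\<epsilon> < shannon_entropy (?p (Suc n)) - shannon_entropy (?p n)" for n by (simp add: not_le)
    then have "(\<Sum>n<(2::nat) ^ k. \<epsilon>) < (\<Sum>n<(2::nat) ^ k. shannon_entropy (?p (Suc n)) - shannon_entropy (?p n))"
      by (intro sum_strict_mono) (auto simp: lessThan_empty_iff)
    also have "\<dots> = shannon_entropy (?p (2 ^ k)) - shannon_entropy (?p 0)" by (rule sum_lessThan_telescope)
    also have "shannon_entropy (?p 0) = 0" by (simp add: shannon_entropy_def)
    finally show False using total by simp
  qed
qed

end

section \<open>Translation energies of finitely supported functions\<close>

definition fin_supp :: "('a, 'm) monoid_scheme \<Rightarrow> ('a \<Rightarrow> real) \<Rightarrow> bool" where
  "fin_supp G f \<longleftrightarrow> finite {x. f x \<noteq> 0} \<and> {x. f x \<noteq> 0} \<subseteq> carrier G"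

definition sq_norm :: "('a, 'm) monoid_scheme \<Rightarrow> ('a \<Rightarrow> real) \<Rightarrow> real" where
  "sq_norm G f = (\<Sum>\<^sub>\<infinity>x\<in>carrier G. (f x)\<^sup>2)"

text \<open>
  The squared distance in \<open>l\<^sup>2\<close> between \<open>f\<close> and its right translate by \<open>z\<close>.
\<close>

definition shift_energy :: "('a, 'm) monoid_scheme \<Rightarrow> ('a \<Rightarrow> real) \<Rightarrow> 'a \<Rightarrow> real" where
  "shift_energy G f z = (\<Sum>\<^sub>\<infinity>x\<in>carrier G. (f x - f (x \<otimes>\<^bsub>G\<^esub> z))\<^sup>2)"

text \<open>
  This is \<open>2 \<langle>f, (I - P) f\<rangle>\<close>, where \<open>P\<close> is the transition operator of the walk with
  step law \<open>p\<close>.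
\<close>

definition dirichlet_energy :: "('a, 'm) monoid_scheme \<Rightarrow> 'a pmf \<Rightarrow> ('a \<Rightarrow> real) \<Rightarrow> real" where
  "dirichlet_energy G p f = (\<integral>z. shift_energy G f z \<partial>p)"

lemma infsum_carrier_finite:
  fixes w :: "'a \<Rightarrow> real"
  assumes "finite A" and "A \<subseteq> C" and "\<And>x. x \<in> C \<Longrightarrow> x \<notin> A \<Longrightarrow> w x = 0"
  shows "(\<Sum>\<^sub>\<infinity>x\<in>C. w x) = (\<Sum>x\<in>A. w x)" and "w summable_on C"
proof -
  show "(\<Sum>\<^sub>\<infinity>x\<in>C. w x) = (\<Sum>x\<in>A. w x)"
    using assms by (subst infsum_cong_neutral[of A C w w]) auto
  show "w summable_on C"
    using assms by (intro finite_nonzero_values_imp_summable_on) (auto intro: finite_subset[of _ A])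
qed

lemma fin_supp_bounded:
  assumes "fin_supp G f"
  obtains B where "0 \<le> B" and "\<And>x. \<bar>f x\<bar> \<le> B"
proof -
  have fin: "finite {x. f x \<noteq> 0}" using assms by (simp add: fin_supp_def)
  show ?thesis
  proof
    show "0 \<le> (\<Sum>x | f x \<noteq> 0. \<bar>f x\<bar>)" by (intro sum_nonneg) simp
    fix x
    show "\<bar>f x\<bar> \<le> (\<Sum>x | f x \<noteq> 0. \<bar>f x\<bar>)"
    proof (cases "f x = 0")
      case False
      then show ?thesis using fin member_le_sum[of x "{x. f x \<noteq> 0}" "\<lambda>x. \<bar>f x\<bar>"] by simp
    qed (simp add: sum_nonneg)
  qed
qed

lemma sq_norm_eq_sum:
  assumes "fin_supp G f"
  shows "sq_norm G f = (\<Sum>x | f x \<noteq> 0. (f x)\<^sup>2)"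
  unfolding sq_norm_def using assms by (intro infsum_carrier_finite) (auto simp: fin_supp_def)

context group
begin

lemma bij_betw_right_mult:
  assumes "z \<in> carrier G" shows "bij_betw (\<lambda>x. x \<otimes> z) (carrier G) (carrier G)"
proof (rule bij_betwI[where g = "\<lambda>x. x \<otimes> inv z"])
qed (use assms in \<open>auto simp: m_assoc\<close>)

lemma infsum_right_translate:
  assumes "z \<in> carrier G"
  shows "(\<Sum>\<^sub>\<infinity>x\<in>carrier G. (w (x \<otimes> z) :: real)) = (\<Sum>\<^sub>\<infinity>x\<in>carrier G. w x)"
  by (rule infsum_reindex_bij_betw[OF bij_betw_right_mult[OF assms]])

lemma finite_translated_support:
  assumes "fin_supp G f" and "z \<in> carrier G"
  shows "finite {x \<in> carrier G. f (x \<otimes> z) \<noteq> 0}"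
proof (rule finite_subset)
  show "{x \<in> carrier G. f (x \<otimes> z) \<noteq> 0} \<subseteq> (\<lambda>y. y \<otimes> inv z) ` {x. f x \<noteq> 0}"
  proof
    fix x assume x: "x \<in> {x \<in> carrier G. f (x \<otimes> z) \<noteq> 0}"
    then have "x = (x \<otimes> z) \<otimes> inv z" using assms(2) by (simp add: m_assoc)
    then show "x \<in> (\<lambda>y. y \<otimes> inv z) ` {x. f x \<noteq> 0}" using x by blast
  qed
  show "finite ((\<lambda>y. y \<otimes> inv z) ` {x. f x \<noteq> 0})" using assms by (simp add: fin_supp_def)
qed

lemma summable_on_translates:
  fixes w :: "'a \<Rightarrow> real"
  assumes f: "fin_supp G f" and Z: "finite Z" "Z \<subseteq> carrier G"
    and w: "\<And>x. x \<in> carrier G \<Longrightarrow> f x = 0 \<Longrightarrow> (\<And>z. z \<in> Z \<Longrightarrow> f (x \<otimes> z) = 0) \<Longrightarrow> w x = 0"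
  shows "w summable_on carrier G"
proof (rule infsum_carrier_finite(2))
  let ?A = "{x. f x \<noteq> 0} \<union> (\<Union>z\<in>Z. {x \<in> carrier G. f (x \<otimes> z) \<noteq> 0})"
  show "finite ?A" using f Z finite_translated_support[OF f] by (auto simp: fin_supp_def)
  show "?A \<subseteq> carrier G" using f by (auto simp: fin_supp_def)
  show "w x = 0" if "x \<in> carrier G" "x \<notin> ?A" for x
    using that by (intro w) auto
qed

lemma summable_on_shift_energy:
  assumes "fin_supp G f" and "z \<in> carrier G" and "w \<in> carrier G"
  shows "(\<lambda>x. (f (x \<otimes> w) - f (x \<otimes> z))\<^sup>2) summable_on carrier G"
  using assms by (intro summable_on_translates[of f "{z, w}"]) auto

lemma shift_energy_nonneg: "0 \<le> shift_energy G f z"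
  unfolding shift_energy_def by (intro infsum_nonneg) simp

lemma shift_energy_one: "shift_energy G f \<one> = 0"
  unfolding shift_energy_def by (rule infsum_0) simp

lemma shift_energy_translate:
  assumes "x \<in> carrier G" and "y \<in> carrier G"
  shows "(\<Sum>\<^sub>\<infinity>u\<in>carrier G. (f (u \<otimes> x) - f (u \<otimes> (x \<otimes> y)))\<^sup>2) = shift_energy G f y"
proof -
  have "(\<Sum>\<^sub>\<infinity>u\<in>carrier G. (f (u \<otimes> x) - f (u \<otimes> (x \<otimes> y)))\<^sup>2)
      = (\<Sum>\<^sub>\<infinity>u\<in>carrier G. (f (u \<otimes> x) - f ((u \<otimes> x) \<otimes> y))\<^sup>2)"
    using assms by (intro infsum_cong) (simp add: m_assoc)
  also have "\<dots> = shift_energy G f y"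
    unfolding shift_energy_def using assms(1) by (rule infsum_right_translate)
  finally show ?thesis .
qed

lemma shift_energy_inv:
  assumes "z \<in> carrier G"
  shows "shift_energy G f (inv z) = shift_energy G f z"
proof -
  have "shift_energy G f (inv z) = (\<Sum>\<^sub>\<infinity>u\<in>carrier G. (f (u \<otimes> z) - f (u \<otimes> (z \<otimes> inv z)))\<^sup>2)"
    using assms by (intro shift_energy_translate[symmetric]) auto
  also have "\<dots> = shift_energy G f z"
    unfolding shift_energy_def using assms by (intro infsum_cong) (simp add: power2_commute)
  finally show ?thesis .
qed

text \<open>
  The triangle inequality for the \<open>l\<^sup>2\<close>-distance, squared.  The free weight \<open>c\<close> makes a product of \<open>n\<close>
  factors cost \<open>n\<^sup>2\<close> and not an exponential.
\<close>

lemma shift_energy_mult_le: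
  assumes f: "fin_supp G f" and z: "z \<in> carrier G" and w: "w \<in> carrier G" and c: "0 < (c :: real)"
  shows "shift_energy G f (z \<otimes> w) \<le> (1 + c) * shift_energy G f z + (1 + 1 / c) * shift_energy G f w"
proof -
  let ?a = "\<lambda>x. (f x - f (x \<otimes> z))\<^sup>2" and ?b = "\<lambda>x. (f (x \<otimes> z) - f (x \<otimes> (z \<otimes> w)))\<^sup>2"
  have a: "?a summable_on carrier G"
    using f z by (intro summable_on_translates[of f "{z}"]) auto
  have b: "?b summable_on carrier G" using f z w by (intro summable_on_shift_energy) auto
  have le: "(f x - f (x \<otimes> (z \<otimes> w)))\<^sup>2 \<le> (1 + c) * ?a x + (1 + 1 / c) * ?b x" for x
  proof -
    have ineq: "(s + t)\<^sup>2 \<le> (1 + c) * s\<^sup>2 + (1 + 1 / c) * t\<^sup>2" for s t :: real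
    proof -
      have "0 \<le> (c * s - t)\<^sup>2 / c" using c by simp
      also have "\<dots> = c * s\<^sup>2 + t\<^sup>2 / c - 2 * s * t" using c by (simp add: field_simps power2_eq_square)
      finally show ?thesis by (simp add: power2_sum algebra_simps)
    qed
    show ?thesis using ineq[of "f x - f (x \<otimes> z)" "f (x \<otimes> z) - f (x \<otimes> (z \<otimes> w))"] by simp
  qed
  have "shift_energy G f (z \<otimes> w) \<le> (\<Sum>\<^sub>\<infinity>x\<in>carrier G. (1 + c) * ?a x + (1 + 1 / c) * ?b x)"
    unfolding shift_energy_def
  proof (rule infsum_mono)
    show "(\<lambda>x. (f x - f (x \<otimes> (z \<otimes> w)))\<^sup>2) summable_on carrier G"
      using f z w by (intro summable_on_translates[of f "{z \<otimes> w}"]) auto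
    show "(\<lambda>x. (1 + c) * ?a x + (1 + 1 / c) * ?b x) summable_on carrier G"
      using a b by (intro summable_on_add summable_on_cmult_right)
  qed (rule le)
  also have "\<dots> = (1 + c) * infsum ?a (carrier G) + (1 + 1 / c) * infsum ?b (carrier G)"
    using a b by (subst infsum_add) (auto intro: summable_on_cmult_right simp: infsum_cmult_right')
  also have "infsum ?b (carrier G) = shift_energy G f w" using z w by (rule shift_energy_translate)
  finally show ?thesis by (simp add: shift_energy_def)
qed

lemma shift_energy_eq:
  assumes f: "fin_supp G f" and z: "z \<in> carrier G"
  shows "shift_energy G f z = 2 * sq_norm G f - 2 * (\<Sum>x | f x \<noteq> 0. f x * f (x \<otimes> z))"
proof -
  have s1: "(\<lambda>x. (f x)\<^sup>2) summable_on carrier G"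
    using f by (intro summable_on_translates[of f "{}"]) auto
  have s2: "(\<lambda>x. (f (x \<otimes> z))\<^sup>2) summable_on carrier G"
    using f z by (intro summable_on_translates[of f "{z}"]) auto
  have s3: "(\<lambda>x. - 2 * (f x * f (x \<otimes> z))) summable_on carrier G"
    using f z by (intro summable_on_translates[of f "{z}"]) auto
  have "shift_energy G f z = (\<Sum>\<^sub>\<infinity>x\<in>carrier G. ((f x)\<^sup>2 + (f (x \<otimes> z))\<^sup>2) + - 2 * (f x * f (x \<otimes> z)))"
    unfolding shift_energy_def by (intro infsum_cong) (simp add: power2_diff algebra_simps)
  also have "\<dots> = (\<Sum>\<^sub>\<infinity>x\<in>carrier G. (f x)\<^sup>2) + (\<Sum>\<^sub>\<infinity>x\<in>carrier G. (f (x \<otimes> z))\<^sup>2)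
      + (\<Sum>\<^sub>\<infinity>x\<in>carrier G. - 2 * (f x * f (x \<otimes> z)))"
    using s1 s2 s3 by (simp only: infsum_add summable_on_add)
  also have "(\<Sum>\<^sub>\<infinity>x\<in>carrier G. (f (x \<otimes> z))\<^sup>2) = (\<Sum>\<^sub>\<infinity>x\<in>carrier G. (f x)\<^sup>2)"
    using z by (rule infsum_right_translate)
  also have "(\<Sum>\<^sub>\<infinity>x\<in>carrier G. - 2 * (f x * f (x \<otimes> z))) = - 2 * (\<Sum>\<^sub>\<infinity>x\<in>carrier G. f x * f (x \<otimes> z))"
    by (rule infsum_cmult_right')
  also have "(\<Sum>\<^sub>\<infinity>x\<in>carrier G. f x * f (x \<otimes> z)) = (\<Sum>x | f x \<noteq> 0. f x * f (x \<otimes> z))"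
    using f by (intro infsum_carrier_finite) (auto simp: fin_supp_def)
  finally show ?thesis by (simp add: sq_norm_def)
qed

lemma shift_energy_le_sq_norm:
  assumes f: "fin_supp G f" and z: "z \<in> carrier G"
  shows "shift_energy G f z \<le> 4 * sq_norm G f"
proof -
  have s1: "(\<lambda>x. (f x)\<^sup>2) summable_on carrier G"
    using f by (intro summable_on_translates[of f "{}"]) auto
  have s2: "(\<lambda>x. (f (x \<otimes> z))\<^sup>2) summable_on carrier G"
    using f z by (intro summable_on_translates[of f "{z}"]) auto
  have "shift_energy G f z \<le> (\<Sum>\<^sub>\<infinity>x\<in>carrier G. 2 * (f x)\<^sup>2 + 2 * (f (x \<otimes> z))\<^sup>2)"
    unfolding shift_energy_def
  proof (rule infsum_mono)
    show "(\<lambda>x. (f x - f (x \<otimes> z))\<^sup>2) summable_on carrier G"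
      using f z by (intro summable_on_translates[of f "{z}"]) auto
    show "(\<lambda>x. 2 * (f x)\<^sup>2 + 2 * (f (x \<otimes> z))\<^sup>2) summable_on carrier G"
      using s1 s2 by (intro summable_on_add summable_on_cmult_right)
    show "(f x - f (x \<otimes> z))\<^sup>2 \<le> 2 * (f x)\<^sup>2 + 2 * (f (x \<otimes> z))\<^sup>2" for x
      using sum_squares_ge_zero[of "f x + f (x \<otimes> z)" 0] by (simp add: power2_eq_square algebra_simps)
  qed
  also have "\<dots> = 2 * (\<Sum>\<^sub>\<infinity>x\<in>carrier G. (f x)\<^sup>2) + 2 * (\<Sum>\<^sub>\<infinity>x\<in>carrier G. (f (x \<otimes> z))\<^sup>2)"
    using s1 s2 by (subst infsum_add) (auto intro: summable_on_cmult_right simp: infsum_cmult_right')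
  also have "(\<Sum>\<^sub>\<infinity>x\<in>carrier G. (f (x \<otimes> z))\<^sup>2) = (\<Sum>\<^sub>\<infinity>x\<in>carrier G. (f x)\<^sup>2)"
    using z by (rule infsum_right_translate)
  finally show ?thesis by (simp add: sq_norm_def)
qed

lemma integrable_shift_energy:
  assumes "fin_supp G f" and "prob_measure_on G p"
  shows "integrable (measure_pmf p) (shift_energy G f)"
  using assms shift_energy_le_sq_norm[OF assms(1)] shift_energy_nonneg
  by (intro measure_pmf.integrable_const_bound[where B = "4 * sq_norm G f"])
    (auto simp: AE_measure_pmf_iff prob_measure_on_def subset_iff)

lemma dirichlet_energy_eq:
  assumes f: "fin_supp G f" and p: "prob_measure_on G p"
  shows "dirichlet_energy G p f
       = 2 * sq_norm G f - 2 * (\<Sum>x | f x \<noteq> 0. f x * (\<integral>z. f (x \<otimes> z) \<partial>p))"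
proof -
  obtain B where B: "\<And>x. \<bar>f x\<bar> \<le> B" using fin_supp_bounded[OF f] by blast
  have int: "integrable (measure_pmf p) (\<lambda>z. f (x \<otimes> z))" for x
    using B by (intro measure_pmf.integrable_const_bound[where B = B]) auto
  have "dirichlet_energy G p f
      = (\<integral>z. 2 * sq_norm G f - 2 * (\<Sum>x | f x \<noteq> 0. f x * f (x \<otimes> z)) \<partial>p)"
    unfolding dirichlet_energy_def using f p shift_energy_eq
    by (intro integral_cong_AE) (auto simp: AE_measure_pmf_iff prob_measure_on_def)
  also have "\<dots> = 2 * sq_norm G f - 2 * (\<Sum>x | f x \<noteq> 0. f x * (\<integral>z. f (x \<otimes> z) \<partial>p))"
    using int by simp
  finally show ?thesis .
qed

text \<open>
  For the self-adjoint operator \<open>Q\<close> of \<open>q\<close> the claim \<open>\<langle>f, (I - Q\<^sup>2) f\<rangle> \<le> 2 \<langle>f, (I - Q) f\<rangle>\<close> says that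
  \<open>f - Q f\<close> has nonnegative square norm.  For \<open>f \<ge> 0\<close> it is enough to bound \<open>\<langle>Q f, Q f\<rangle>\<close> from below by
  the sum over the support of \<open>f\<close>, and all sums are finite.
\<close>

lemma dirichlet_energy_double:
  assumes f: "fin_supp G f" and f_nonneg: "\<And>x. 0 \<le> f x"
    and q: "prob_measure_on G q" and sym: "map_pmf (m_inv G) q = q"
  shows "dirichlet_energy G (convolution_pmf G q q) f \<le> 2 * dirichlet_energy G q f"
proof -
  let ?U = "{x. f x \<noteq> 0}"
  have U: "finite ?U" "?U \<subseteq> carrier G" using f by (auto simp: fin_supp_def)
  obtain B where B: "0 \<le> B" "\<And>x. \<bar>f x\<bar> \<le> B" using fin_supp_bounded[OF f] by blast
  define Q where "Q x = (\<integral>z. f (x \<otimes> z) \<partial>q)" for x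
  have qq: "prob_measure_on G (convolution_pmf G q q)" by (intro prob_measure_on_convolution_pmf q)
  \<comment> \<open>Substitute \<open>y = x \<otimes> inv z\<close> in the left-hand sum; terms with \<open>y\<close> outside the support vanish.\<close>
  have prod_le: "(\<Sum>x\<in>?U. f (x \<otimes> inv z) * f (x \<otimes> w)) \<le> (\<Sum>x\<in>?U. f x * f (x \<otimes> (z \<otimes> w)))"
    if z: "z \<in> carrier G" and w: "w \<in> carrier G" for z w
  proof -
    have "(\<Sum>x\<in>?U. f (x \<otimes> inv z) * f (x \<otimes> w)) = (\<Sum>x\<in>{x \<in> ?U. x \<otimes> inv z \<in> ?U}. f (x \<otimes> inv z) * f (x \<otimes> w))"
      using U by (intro sum.mono_neutral_right) auto
    also have "\<dots> = (\<Sum>x\<in>{x \<in> ?U. x \<otimes> inv z \<in> ?U}. f (x \<otimes> inv z) * f ((x \<otimes> inv z) \<otimes> (z \<otimes> w)))"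
    proof (intro sum.cong refl)
      fix x assume "x \<in> {x \<in> ?U. x \<otimes> inv z \<in> ?U}"
      then have x: "x \<in> carrier G" using U by auto
      have "inv z \<otimes> (z \<otimes> w) = w" using z w by (simp add: m_assoc[symmetric])
      then have "(x \<otimes> inv z) \<otimes> (z \<otimes> w) = x \<otimes> w" using x z w by (simp add: m_assoc)
      then show "f (x \<otimes> inv z) * f (x \<otimes> w) = f (x \<otimes> inv z) * f ((x \<otimes> inv z) \<otimes> (z \<otimes> w))"
        using x z by simp
    qed
    also have "\<dots> = (\<Sum>y\<in>(\<lambda>x. x \<otimes> inv z) ` {x \<in> ?U. x \<otimes> inv z \<in> ?U}. f y * f (y \<otimes> (z \<otimes> w)))"
    proof (subst sum.reindex)
      show "inj_on (\<lambda>x. x \<otimes> inv z) {x \<in> ?U. x \<otimes> inv z \<in> ?U}"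
        using bij_betw_imp_inj_on[OF bij_betw_right_mult[of "inv z"]] z U(2) by (auto intro: inj_on_subset)
    qed simp
    also have "\<dots> \<le> (\<Sum>x\<in>?U. f x * f (x \<otimes> (z \<otimes> w)))"
      using U f_nonneg by (intro sum_mono2) auto
    finally show ?thesis .
  qed
  have E_left: "(\<integral>z. f (x \<otimes> inv z) \<partial>q) = Q x" for x
  proof -
    have "Q x = (\<integral>z. f (x \<otimes> z) \<partial>map_pmf (m_inv G) q)" by (simp add: Q_def sym)
    then show ?thesis by simp
  qed
  have bdd2: "\<bar>f a * f b\<bar> \<le> B * B" for a b
    using B mult_mono[OF B(2)[of a] B(2)[of b]] by (simp add: abs_mult)
  have int2: "integrable (measure_pmf p) (\<lambda>z. f (k z) * f (l z))" for k l and p :: "'c pmf"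
    using bdd2 by (intro measure_pmf.integrable_const_bound[where B = "B * B"]) auto
  have "2 * (\<Sum>x\<in>?U. f x * Q x) - sq_norm G f = (\<Sum>x\<in>?U. 2 * (f x * Q x) - (f x)\<^sup>2)"
    by (simp add: sq_norm_eq_sum[OF f] sum_subtractf sum_distrib_left)
  also have "\<dots> \<le> (\<Sum>x\<in>?U. (Q x)\<^sup>2)"
  proof (rule sum_mono)
    fix x
    show "2 * (f x * Q x) - (f x)\<^sup>2 \<le> (Q x)\<^sup>2"
      using sum_squares_ge_zero[of "f x - Q x" 0] by (simp add: power2_eq_square algebra_simps)
  qed
  also have "\<dots> = (\<Sum>x\<in>?U. (\<integral>z. (case z of (z, w) \<Rightarrow> f (x \<otimes> inv z) * f (x \<otimes> w)) \<partial>pair_pmf q q))"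
  proof (intro sum.cong refl)
    fix x
    have "(\<integral>z. (case z of (z, w) \<Rightarrow> f (x \<otimes> inv z) * f (x \<otimes> w)) \<partial>pair_pmf q q)
        = (\<integral>z. (\<integral>w. f (x \<otimes> inv z) * f (x \<otimes> w) \<partial>q) \<partial>q)"
      using bdd2 by (subst expectation_pair_pmf_bounded[where K = "B * B"]) auto
    also have "\<dots> = (\<integral>z. f (x \<otimes> inv z) \<partial>q) * (\<integral>w. f (x \<otimes> w) \<partial>q)"
      by simp
    also have "\<dots> = (Q x)\<^sup>2" by (simp only: E_left Q_def[symmetric] power2_eq_square)
    finally show "(Q x)\<^sup>2 = (\<integral>z. (case z of (z, w) \<Rightarrow> f (x \<otimes> inv z) * f (x \<otimes> w)) \<partial>pair_pmf q q)" by simp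
  qed
  also have "\<dots> = (\<integral>z. (\<Sum>x\<in>?U. f (x \<otimes> inv (fst z)) * f (x \<otimes> snd z)) \<partial>pair_pmf q q)"
    unfolding case_prod_beta' by (rule Bochner_Integration.integral_sum[symmetric]) (rule int2)
  also have "\<dots> \<le> (\<integral>z. (\<Sum>x\<in>?U. f x * f (x \<otimes> (fst z \<otimes> snd z))) \<partial>pair_pmf q q)"
    using prod_le q
    by (intro integral_mono_AE Bochner_Integration.integrable_sum int2) (auto simp: AE_measure_pmf_iff prob_measure_on_def subset_iff)
  also have "\<dots> = (\<Sum>x\<in>?U. (\<integral>z. f x * f (x \<otimes> (fst z \<otimes> snd z)) \<partial>pair_pmf q q))"
    by (rule Bochner_Integration.integral_sum) (rule int2)
  also have "\<dots> = (\<Sum>x\<in>?U. f x * (\<integral>z. f (x \<otimes> (fst z \<otimes> snd z)) \<partial>pair_pmf q q))"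
    by simp
  also have "\<dots> = (\<Sum>x\<in>?U. f x * (\<integral>z. f (x \<otimes> z) \<partial>convolution_pmf G q q))"
    by (simp add: convolution_pmf_def case_prod_beta')
  finally have "2 * (\<Sum>x\<in>?U. f x * Q x) - sq_norm G f
      \<le> (\<Sum>x\<in>?U. f x * (\<integral>z. f (x \<otimes> z) \<partial>convolution_pmf G q q))" .
  then show ?thesis
    unfolding dirichlet_energy_eq[OF f q] dirichlet_energy_eq[OF f qq] Q_def by simp
qed

text \<open>
  Linear growth in time is what makes the time scale \<open>\<surd>n\<close> reachable; the triangle inequality alone would
  give quadratic growth.
\<close>

lemma dirichlet_energy_dyadic:
  assumes f: "fin_supp G f" "\<And>x. 0 \<le> f x"
    and p: "prob_measure_on G p" "map_pmf (m_inv G) p = p"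
  shows "dirichlet_energy G (convolution_power G p (2 ^ k)) f \<le> 2 ^ k * dirichlet_energy G p f"
proof (induction k)
  case 0
  then show ?case using p by (simp add: convolution_pmf_one_left)
next
  case (Suc k)
  let ?q = "convolution_power G p (2 ^ k)"
  have "convolution_power G p (2 ^ Suc k) = convolution_pmf G ?q ?q"
    using convolution_power_add[OF p(1), of "2 ^ k" "2 ^ k"] by (simp add: mult_2)
  then have "dirichlet_energy G (convolution_power G p (2 ^ Suc k)) f \<le> 2 * dirichlet_energy G ?q f"
    using dirichlet_energy_double[OF f prob_measure_on_convolution_power[OF p(1)]
        map_inv_convolution_power[OF p], of "2 ^ k"] by simp
  then show ?case using Suc by simp
qed

text \<open>
  Every jump between the support of \<open>f\<close> and its complement contributes the full square of the nonzero
  value to the energy.  If the walk starts at \<open>x\<close> with probability proportional to \<open>(f x)\<^sup>2\<close>, the probability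
  to end outside the support is therefore at most \<open>\<epsilon>\<close>, and some starting point does as well as
  the average.  Translation of the support by this point gives \<open>V\<close>.
\<close>

lemma concentration_of_small_energy:
  assumes f: "fin_supp G f" "0 < sq_norm G f"
    and q: "prob_measure_on G q" "map_pmf (m_inv G) q = q"
    and energy: "dirichlet_energy G q f \<le> 2 * \<epsilon> * sq_norm G f"
  shows "\<exists>V. finite V \<and> V \<noteq> {} \<and> card V \<le> card {x. f x \<noteq> 0} \<and> measure q (- V) \<le> \<epsilon>"
proof -
  let ?U = "{x. f x \<noteq> 0}"
  have U: "finite ?U" "?U \<subseteq> carrier G" using f by (auto simp: fin_supp_def)
  \<comment> \<open>The factor 2 comes from counting jumps out of the support and, by symmetry, jumps into it.\<close>
  define ex where "ex x z = (if x \<otimes> z \<in> ?U then 0 else 1 :: real)" for x z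
  have lower: "(\<Sum>x\<in>?U. (f x)\<^sup>2 * ex x z) + (\<Sum>x\<in>?U. (f x)\<^sup>2 * ex x (inv z)) \<le> shift_energy G f z"
    if z: "z \<in> carrier G" for z
  proof -
    let ?a = "\<lambda>x. (f x)\<^sup>2 * ex x z" and ?b = "\<lambda>x. (f x)\<^sup>2 * ex x (inv z)"
    have a: "?a summable_on carrier G"
      using U by (intro infsum_carrier_finite(2)[of ?U]) auto
    have a': "(\<Sum>\<^sub>\<infinity>x\<in>carrier G. ?a x) = (\<Sum>x\<in>?U. ?a x)"
      using U by (intro infsum_carrier_finite(1)) auto
    have b: "(\<Sum>\<^sub>\<infinity>x\<in>carrier G. ?b x) = (\<Sum>x\<in>?U. ?b x)"
      using U by (intro infsum_carrier_finite) auto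
    have b': "(\<lambda>x. ?b (x \<otimes> z)) summable_on carrier G"
      using f z by (intro summable_on_translates[of f "{z}"]) auto
    have "(\<Sum>x\<in>?U. ?a x) + (\<Sum>x\<in>?U. ?b x) = (\<Sum>\<^sub>\<infinity>x\<in>carrier G. ?a x) + (\<Sum>\<^sub>\<infinity>x\<in>carrier G. ?b (x \<otimes> z))"
      using a' b infsum_right_translate[OF z, of ?b] by simp
    also have "\<dots> = (\<Sum>\<^sub>\<infinity>x\<in>carrier G. ?a x + ?b (x \<otimes> z))" using a b' by (rule infsum_add[symmetric])
    also have "\<dots> \<le> shift_energy G f z"
      unfolding shift_energy_def
    proof (rule infsum_mono)
      show "(\<lambda>x. ?a x + ?b (x \<otimes> z)) summable_on carrier G" using a b' by (rule summable_on_add)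
      show "(\<lambda>x. (f x - f (x \<otimes> z))\<^sup>2) summable_on carrier G"
        using f z by (intro summable_on_translates[of f "{z}"]) auto
      show "?a x + ?b (x \<otimes> z) \<le> (f x - f (x \<otimes> z))\<^sup>2" if "x \<in> carrier G" for x
        using that z by (auto simp: ex_def m_assoc)
    qed
    finally show ?thesis .
  qed
  define m where "m x = (\<integral>z. ex x z \<partial>q)" for x
  have int: "integrable (measure_pmf q) (\<lambda>z. ex x (k z))" for x k
    by (intro measure_pmf.integrable_const_bound[where B = 1]) (auto simp: ex_def)
  have m_inv: "(\<integral>z. ex x (inv z) \<partial>q) = m x" for x
  proof -
    have "m x = (\<integral>z. ex x z \<partial>map_pmf (m_inv G) q)" by (simp add: m_def q(2))
    then show ?thesis by simp
  qed
  have "2 * (\<Sum>x\<in>?U. (f x)\<^sup>2 * m x)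
      = (\<integral>z. (\<Sum>x\<in>?U. (f x)\<^sup>2 * ex x z) + (\<Sum>x\<in>?U. (f x)\<^sup>2 * ex x (inv z)) \<partial>q)"
    using int[of _ "\<lambda>z. z"] int[of _ "m_inv G"] by (simp add: m_inv) (simp add: m_def)
  also have "\<dots> \<le> dirichlet_energy G q f"
    unfolding dirichlet_energy_def
    using int[of _ "\<lambda>z. z"] int[of _ "m_inv G"] lower q(1) integrable_shift_energy[OF f(1) q(1)]
    by (intro integral_mono_AE) (auto simp: AE_measure_pmf_iff prob_measure_on_def subset_iff)
  finally have sum_le: "(\<Sum>x\<in>?U. (f x)\<^sup>2 * m x) \<le> \<epsilon> * (\<Sum>x\<in>?U. (f x)\<^sup>2)"
    using energy by (simp add: sq_norm_eq_sum[OF f(1)])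
  have U_ne: "?U \<noteq> {}"
  proof
    assume "?U = {}"
    then show False using f by (simp add: sq_norm_eq_sum)
  qed
  have "\<exists>x\<in>?U. m x \<le> \<epsilon>"
  proof (rule ccontr)
    assume "\<not> (\<exists>x\<in>?U. m x \<le> \<epsilon>)"
    then have "(\<Sum>x\<in>?U. (f x)\<^sup>2 * \<epsilon>) < (\<Sum>x\<in>?U. (f x)\<^sup>2 * m x)"
      using U U_ne by (intro sum_strict_mono mult_strict_left_mono) auto
    then show False using sum_le by (simp add: sum_distrib_left mult.commute)
  qed
  then obtain x where x: "x \<in> ?U" "m x \<le> \<epsilon>" by blast
  have xc: "x \<in> carrier G" using x U by blast
  define V where "V = (\<lambda>y. inv x \<otimes> y) ` ?U"
  show ?thesis
  proof (intro exI[of _ V] conjI)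
    show "finite V" "V \<noteq> {}" "card V \<le> card ?U" using U U_ne by (simp_all add: V_def card_image_le)
    have "measure q (- V) \<le> (\<integral>z. ex x z \<partial>q)"
    proof -
      have "measure q (- V) = (\<integral>z. indicator (- V) z \<partial>q)" by simp
      also have "\<dots> \<le> (\<integral>z. ex x z \<partial>q)"
      proof (rule integral_mono_AE)
        show "integrable (measure_pmf q) (indicat_real (- V))"
          by (intro measure_pmf.integrable_const_bound[where B = 1]) (auto simp: indicator_def)
        show "AE z in measure_pmf q. indicat_real (- V) z \<le> ex x z"
        proof (rule AE_pmfI)
          fix z assume "z \<in> set_pmf q"
          then have z: "z \<in> carrier G" using q(1) by (auto simp: prob_measure_on_def)
          have "z = inv x \<otimes> (x \<otimes> z)" using z xc by (simp add: m_assoc[symmetric])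
          then have "z \<in> V" if "x \<otimes> z \<in> ?U" using that unfolding V_def by blast
          then show "indicat_real (- V) z \<le> ex x z" by (auto simp: ex_def indicator_def)
        qed
      qed (use int[of x "\<lambda>z. z"] in simp)
      finally show ?thesis .
    qed
    then show "measure q (- V) \<le> \<epsilon>" using x(2) by (simp add: m_def)
  qed
qed

text \<open>
  An element of the support has positive weight in the Dirichlet energy, and the translation energies of
  other elements are controlled along a factorization.
\<close>

lemma ex_shift_energy_le_dirichlet_energy:
  assumes \<mu>: "prob_measure_on G \<mu>" "generating_support G \<mu>" and h: "h \<in> carrier G"
  shows "\<exists>c\<ge>0. \<forall>f. fin_supp G f \<longrightarrow> shift_energy G f h \<le> c * dirichlet_energy G \<mu> f"
proof -
  have in_support: "\<exists>c\<ge>0. \<forall>f. fin_supp G f \<longrightarrow> shift_energy G f h \<le> c * dirichlet_energy G \<mu> f"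
    if h: "h \<in> set_pmf \<mu>" for h
  proof (intro exI[of _ "1 / pmf \<mu> h"] conjI allI impI)
    fix f assume f: "fin_supp G f"
    have pos: "0 < pmf \<mu> h" using h by (simp add: pmf_positive)
    have "shift_energy G f h * pmf \<mu> h = (\<integral>z. shift_energy G f h * indicator {h} z \<partial>\<mu>)"
      by (simp add: measure_pmf_single)
    also have "\<dots> \<le> dirichlet_energy G \<mu> f"
      unfolding dirichlet_energy_def
    proof (rule integral_mono)
      show "integrable (measure_pmf \<mu>) (\<lambda>z. shift_energy G f h * indicator {h} z)"
        by (intro integrable_mult_right measure_pmf.integrable_const_bound[where B = 1]) (auto simp: indicator_def)
      show "shift_energy G f h * indicator {h} z \<le> shift_energy G f z" for z
        using shift_energy_nonneg by (auto simp: indicator_def)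
    qed (rule integrable_shift_energy[OF f \<mu>(1)])
    finally show "shift_energy G f h \<le> 1 / pmf \<mu> h * dirichlet_energy G \<mu> f"
      using pos by (simp add: field_simps)
  qed simp
  have "h \<in> generate G (set_pmf \<mu>)" using \<mu>(2) h by (simp add: generating_support_def)
  then show ?thesis
  proof induction
    case one
    then show ?case by (intro exI[of _ 0]) (simp add: shift_energy_one)
  next
    case (incl h)
    then show ?case by (rule in_support)
  next
    case (inv h)
    then have "h \<in> carrier G" using \<mu>(1) by (auto simp: prob_measure_on_def)
    then show ?case using in_support[OF inv] by (simp add: shift_energy_inv)
  next
    case (eng h1 h2)
    then obtain c1 c2 where c: "0 \<le> c1" "0 \<le> c2"
      and c1: "\<And>f. fin_supp G f \<Longrightarrow> shift_energy G f h1 \<le> c1 * dirichlet_energy G \<mu> f"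
      and c2: "\<And>f. fin_supp G f \<Longrightarrow> shift_energy G f h2 \<le> c2 * dirichlet_energy G \<mu> f" by blast
    have h12: "h1 \<in> carrier G" "h2 \<in> carrier G" using eng \<mu>(2) by (auto simp: generating_support_def)
    show ?case
    proof (intro exI[of _ "2 * c1 + 2 * c2"] conjI allI impI)
      fix f assume f: "fin_supp G f"
      show "shift_energy G f (h1 \<otimes> h2) \<le> (2 * c1 + 2 * c2) * dirichlet_energy G \<mu> f"
        using shift_energy_mult_le[OF f h12, of 1] c1[OF f] c2[OF f] by (simp add: algebra_simps)
    qed (use c in simp)
  qed
qed

end

context word_metric
begin

lemma shift_energy_le_word_length_square:
  assumes f: "fin_supp G f" and D: "\<And>s. s \<in> S \<Longrightarrow> shift_energy G f s \<le> D" and z: "z \<in> carrier G"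
  shows "shift_energy G f z \<le> (real (wl z))\<^sup>2 * D"
proof -
  have letter: "shift_energy G f s \<le> D" if "s \<in> letters" for s
    using that D fgs by (auto simp: shift_energy_inv finite_generating_set_def subset_iff)
  have "shift_energy G f (eval_word ws) \<le> (real (length ws))\<^sup>2 * D" if "set ws \<subseteq> letters" for ws
    using that
  proof (induction ws)
    case (Cons w ws)
    then have w: "w \<in> carrier G" "w \<in> letters" and ws: "eval_word ws \<in> carrier G"
      using letters_carrier eval_word_closed[of ws] by auto
    show ?case
    proof (cases "ws = []")
      case True
      then show ?thesis using letter[OF w(2)] w(1) by simp
    next
      case False
      define n where "n = real (length ws)"
      have n: "0 < n" using False by (simp add: n_def)
      have "shift_energy G f (eval_word (w # ws))
          \<le> (1 + n) * shift_energy G f w + (1 + 1 / n) * shift_energy G f (eval_word ws)"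
        using shift_energy_mult_le[OF f w(1) ws n] by simp
      also have "\<dots> \<le> (1 + n) * D + (1 + 1 / n) * (n\<^sup>2 * D)"
        using n letter[OF w(2)] Cons by (intro add_mono mult_left_mono) (auto simp: n_def)
      also have "\<dots> = (1 + n)\<^sup>2 * D" using n by (simp add: field_simps power2_eq_square)
      finally show ?thesis by (simp add: n_def)
    qed
  qed (simp add: shift_energy_one)
  then show ?thesis using ex_geodesic_word[OF z] by metis
qed

lemma dirichlet_energy_le_second_moment:
  assumes f: "fin_supp G f" and D: "\<And>s. s \<in> S \<Longrightarrow> shift_energy G f s \<le> D"
    and p: "prob_measure_on G p" "integrable (measure_pmf p) (\<lambda>g. (real (wl g))\<^sup>2)"
  shows "dirichlet_energy G p f \<le> (\<integral>g. (real (wl g))\<^sup>2 \<partial>p) * D"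
proof -
  have "dirichlet_energy G p f \<le> (\<integral>g. (real (wl g))\<^sup>2 * D \<partial>p)"
    unfolding dirichlet_energy_def
    using integrable_shift_energy[OF f p(1)] p shift_energy_le_word_length_square[OF f D]
    by (intro integral_mono_AE) (auto simp: AE_measure_pmf_iff prob_measure_on_def)
  then show ?thesis by simp
qed

end

section \<open>Functions of small energy from return probabilities\<close>

text \<open>
  Otherwise \<open>b\<close> would shrink at each of \<open>n\<close> steps by more than the factor \<open>exp (- (c + ln 2) / n)\<close> and,
  starting from at most 2, end below \<open>exp (- c)\<close>.
\<close>

lemma ex_small_relative_decrement:
  fixes b :: "nat \<Rightarrow> real"
  assumes n: "0 < n" and b0: "0 < b 0" "b 0 \<le> 2" and pos: "\<And>m. 0 \<le> b m"
    and bn: "exp (- c) \<le> b n"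
  shows "\<exists>m<n. b m - b (Suc m) \<le> (c + ln 2) / n * b m"
proof (rule ccontr)
  define l where "l = (c + ln 2) / n"
  assume "\<not> ?thesis"
  then have step: "b (Suc m) < (1 - l) * b m" if "m < n" for m
    using that by (auto simp: l_def algebra_simps not_le)
  have less: "b (Suc m) < exp (- l * Suc m) * 2" if "m < n" for m
    using that
  proof (induction m)
    case 0
    have "b (Suc 0) < (1 - l) * b 0" using step 0 by simp
    also have "\<dots> \<le> exp (- l) * b 0"
      using exp_ge_add_one_self[of "- l"] pos by (intro mult_right_mono) auto
    also have "\<dots> \<le> exp (- l) * 2" using b0 by (intro mult_left_mono) auto
    finally show ?case by simp
  next
    case (Suc m)
    have "b (Suc (Suc m)) < (1 - l) * b (Suc m)" using step Suc by simp
    also have "\<dots> \<le> exp (- l) * b (Suc m)"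
      using exp_ge_add_one_self[of "- l"] pos by (intro mult_right_mono) auto
    also have "\<dots> \<le> exp (- l) * (exp (- l * Suc m) * 2)" using Suc by (intro mult_left_mono) auto
    also have "\<dots> = exp (- l * Suc (Suc m)) * 2" by (simp add: exp_add[symmetric] algebra_simps)
    finally show ?case .
  qed
  have "b n < exp (- l * n) * 2" using less[of "n - 1"] n by simp
  also have "\<dots> = exp (- c - ln 2) * 2" using n by (simp add: l_def)
  also have "\<dots> = exp (- c)" by (simp add: exp_diff)
  finally show False using bn by simp
qed

context group
begin

lemma pmf_convolution_pmf:
  assumes p: "prob_measure_on G p" and q: "prob_measure_on G q" and x: "x \<in> carrier G"
  shows "pmf (convolution_pmf G p q) x = (\<integral>k. pmf q (inv k \<otimes> x) \<partial>p)"
proof -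
  have "convolution_pmf G p q = bind_pmf p (\<lambda>k. left_translate k q)"
    unfolding convolution_pmf_def pair_pmf_def left_translate_def map_pmf_def bind_assoc_pmf
      bind_return_pmf case_prod_conv ..
  then have "pmf (convolution_pmf G p q) x = (\<integral>k. pmf (left_translate k q) x \<partial>p)"
    by (simp add: pmf_bind)
  also have "\<dots> = (\<integral>k. pmf q (inv k \<otimes> x) \<partial>p)"
  proof (rule integral_cong_AE)
    show "AE k in measure_pmf p. pmf (left_translate k q) x = pmf q (inv k \<otimes> x)"
    proof (rule AE_pmfI)
      fix k assume "k \<in> set_pmf p"
      then have k: "k \<in> carrier G" using p by (auto simp: prob_measure_on_def)
      then show "pmf (left_translate k q) x = pmf q (inv k \<otimes> x)"
        using pmf_left_translate_inv[OF q _ x, of "inv k"] by simp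
    qed
  qed auto
  finally show ?thesis .
qed

lemma fin_supp_pmf:
  assumes "prob_measure_on G p" and "finite (set_pmf p)"
  shows "fin_supp G (pmf p)"
  using assms by (simp add: fin_supp_def prob_measure_on_def set_pmf_eq[symmetric])

lemma finite_convolution_power:
  assumes "finite (set_pmf p)"
  shows "finite (set_pmf (convolution_power G p n))"
  using assms by (induction n) (simp_all add: convolution_pmf_def)

lemma fin_supp_add:
  assumes "fin_supp G f" and "fin_supp G g"
  shows "fin_supp G (\<lambda>x. f x + g x)"
proof -
  have "{x. f x + g x \<noteq> 0} \<subseteq> {x. f x \<noteq> 0} \<union> {x. g x \<noteq> 0}" by auto
  then show ?thesis using assms unfolding fin_supp_def by (meson finite_UnI finite_subset le_sup_iff subset_trans)
qed

lemma infsum_pmf_power_mult: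
  assumes \<mu>: "prob_measure_on G \<mu>" "map_pmf (m_inv G) \<mu> = \<mu>" "finite (set_pmf \<mu>)"
  shows "(\<Sum>\<^sub>\<infinity>x\<in>carrier G. pmf (convolution_power G \<mu> i) x * pmf (convolution_power G \<mu> j) x)
       = pmf (convolution_power G \<mu> (i + j)) \<one>"
proof -
  let ?p = "convolution_power G \<mu>"
  have p: "prob_measure_on G (?p i)" for i using \<mu>(1) by (rule prob_measure_on_convolution_power)
  have "pmf (?p (i + j)) \<one> = (\<integral>k. pmf (?p j) (inv k \<otimes> \<one>) \<partial>?p i)"
    unfolding convolution_power_add[OF \<mu>(1)] by (intro pmf_convolution_pmf p) simp
  also have "\<dots> = (\<Sum>k\<in>set_pmf (?p i). pmf (?p j) (inv k \<otimes> \<one>) * pmf (?p i) k)"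
    by (intro integral_measure_pmf_real finite_convolution_power \<mu>)
  also have "\<dots> = (\<Sum>k\<in>set_pmf (?p i). pmf (?p i) k * pmf (?p j) k)"
  proof (intro sum.cong refl)
    fix k assume "k \<in> set_pmf (?p i)"
    then have k: "k \<in> carrier G" using p[of i] by (auto simp: prob_measure_on_def)
    show "pmf (?p j) (inv k \<otimes> \<one>) * pmf (?p i) k = pmf (?p i) k * pmf (?p j) k"
      using pmf_inv[OF p map_inv_convolution_power[OF \<mu>(1,2)] k] k by simp
  qed
  also have "\<dots> = (\<Sum>\<^sub>\<infinity>x\<in>carrier G. pmf (?p i) x * pmf (?p j) x)"
    using p[of i] finite_convolution_power[OF \<mu>(3), of i]
    by (intro infsum_carrier_finite(1)[symmetric]) (auto simp: prob_measure_on_def set_pmf_iff)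
  finally show ?thesis by simp
qed

lemma expectation_pmf_power_translate:
  assumes \<mu>: "prob_measure_on G \<mu>" "map_pmf (m_inv G) \<mu> = \<mu>" and x: "x \<in> carrier G"
  shows "(\<integral>k. pmf (convolution_power G \<mu> m) (x \<otimes> k) \<partial>\<mu>) = pmf (convolution_power G \<mu> (Suc m)) x"
proof -
  let ?p = "convolution_power G \<mu>"
  have p: "prob_measure_on G (?p i)" for i using \<mu>(1) by (rule prob_measure_on_convolution_power)
  note inv_p = pmf_inv[OF p map_inv_convolution_power[OF \<mu>]]
  have "pmf (?p (Suc m)) x = pmf (?p (Suc m)) (inv x)" using inv_p[OF x, of "Suc m"] by simp
  also have "\<dots> = (\<integral>k. pmf (?p m) (inv k \<otimes> inv x) \<partial>\<mu>)"
    unfolding convolution_power_Suc_left[OF \<mu>(1)] using x by (intro pmf_convolution_pmf \<mu> p) simp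
  also have "\<dots> = (\<integral>k. pmf (?p m) (x \<otimes> k) \<partial>\<mu>)"
  proof (rule integral_cong_AE)
    show "AE k in measure_pmf \<mu>. pmf (?p m) (inv k \<otimes> inv x) = pmf (?p m) (x \<otimes> k)"
    proof (rule AE_pmfI)
      fix k assume "k \<in> set_pmf \<mu>"
      then have k: "k \<in> carrier G" using \<mu>(1) by (auto simp: prob_measure_on_def)
      show "pmf (?p m) (inv k \<otimes> inv x) = pmf (?p m) (x \<otimes> k)"
        using inv_p[of "x \<otimes> k" m] x k by (simp add: inv_mult_group)
    qed
  qed auto
  finally show ?thesis by simp
qed

text \<open>
  The sum of two consecutive powers replaces a single one because of periodicity: if the walk is periodic,
  the even return probabilities do not see the energy of \<open>\<mu>\<close>, only that of its square.  For the sum, both the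
  norm and the energy are read off from return probabilities, through \<open>\<langle>\<mu>\<^sup>i, \<mu>\<^sup>j\<rangle> = \<mu>\<^sup>i\<^sup>+\<^sup>j (\<one>)\<close>.
\<close>

lemma consecutive_convolution_powers:
  assumes \<mu>: "prob_measure_on G \<mu>" "map_pmf (m_inv G) \<mu> = \<mu>" "finite (set_pmf \<mu>)"
  defines "p \<equiv> convolution_power G \<mu>"
  defines "v m x \<equiv> pmf (p m) x + pmf (p (Suc m)) x"
    and "b m \<equiv> pmf (p (2 * m)) \<one> + pmf (p (Suc (2 * m))) \<one>"
  shows "fin_supp G (v m)" and "b m \<le> sq_norm G (v m)"
    and "dirichlet_energy G \<mu> (v m) = 2 * (b m - b (Suc m))"
    and "(\<Sum>x | v m x \<noteq> 0. v m x) \<le> 2"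
proof -
  have p: "prob_measure_on G (p i)" for i unfolding p_def using \<mu>(1) by (rule prob_measure_on_convolution_power)
  have fs_p: "fin_supp G (pmf (p i))" for i
    using p finite_convolution_power[OF \<mu>(3)] by (intro fin_supp_pmf) (auto simp: p_def)
  show fs: "fin_supp G (v m)" for m unfolding v_def by (intro fin_supp_add fs_p)
  have summ: "(\<lambda>x. pmf (p i) x * g x) summable_on carrier G" for i g
    using fs_p[of i] by (intro summable_on_translates[of "pmf (p i)" "{}"]) auto
  have inner_p: "(\<Sum>\<^sub>\<infinity>x\<in>carrier G. pmf (p i) x * pmf (p j) x) = pmf (p (i + j)) \<one>" for i j
    unfolding p_def by (rule infsum_pmf_power_mult[OF \<mu>])
  have inner: "(\<Sum>\<^sub>\<infinity>x\<in>carrier G. v m x * v l x)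
      = pmf (p (m + l)) \<one> + 2 * pmf (p (Suc (m + l))) \<one> + pmf (p (Suc (Suc (m + l)))) \<one>" for m l
  proof -
    have "(\<Sum>\<^sub>\<infinity>x\<in>carrier G. v m x * v l x)
      = (\<Sum>\<^sub>\<infinity>x\<in>carrier G. (pmf (p m) x * pmf (p l) x + pmf (p m) x * pmf (p (Suc l)) x)
           + (pmf (p (Suc m)) x * pmf (p l) x + pmf (p (Suc m)) x * pmf (p (Suc l)) x))"
      by (intro infsum_cong) (simp add: v_def algebra_simps)
    also have "\<dots> = (pmf (p (m + l)) \<one> + pmf (p (m + Suc l)) \<one>) + (pmf (p (Suc m + l)) \<one> + pmf (p (Suc m + Suc l)) \<one>)"
      by (simp only: infsum_add[OF summable_on_add[OF summ summ] summable_on_add[OF summ summ]]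
          infsum_add[OF summ summ] inner_p)
    finally show ?thesis by simp
  qed
  have norm: "sq_norm G (v m) = pmf (p (2 * m)) \<one> + 2 * pmf (p (Suc (2 * m))) \<one> + pmf (p (Suc (Suc (2 * m)))) \<one>"
    using inner[of m m] by (simp add: sq_norm_def power2_eq_square mult_2[symmetric])
  then show "b m \<le> sq_norm G (v m)" by (simp add: b_def)
  have E: "(\<integral>k. v m (x \<otimes> k) \<partial>\<mu>) = v (Suc m) x" if x: "x \<in> carrier G" for x
  proof -
    have "integrable (measure_pmf \<mu>) (\<lambda>k. pmf (p i) (x \<otimes> k))" for i
      by (intro measure_pmf.integrable_const_bound[where B = 1]) (auto simp: pmf_le_1)
    then show ?thesis
      using expectation_pmf_power_translate[OF \<mu>(1,2) x, folded p_def] by (simp add: v_def)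
  qed
  have "dirichlet_energy G \<mu> (v m) = 2 * sq_norm G (v m) - 2 * (\<Sum>x | v m x \<noteq> 0. v m x * v (Suc m) x)"
  proof -
    have "(\<Sum>x | v m x \<noteq> 0. v m x * (\<integral>k. v m (x \<otimes> k) \<partial>\<mu>)) = (\<Sum>x | v m x \<noteq> 0. v m x * v (Suc m) x)"
      using E fs[of m] unfolding fin_supp_def by (intro sum.cong refl) auto
    then show ?thesis unfolding dirichlet_energy_eq[OF fs \<mu>(1)] by simp
  qed
  also have "(\<Sum>x | v m x \<noteq> 0. v m x * v (Suc m) x) = (\<Sum>\<^sub>\<infinity>x\<in>carrier G. v m x * v (Suc m) x)"
    using fs[of m] by (intro infsum_carrier_finite(1)[symmetric]) (auto simp: fin_supp_def)
  finally show "dirichlet_energy G \<mu> (v m) = 2 * (b m - b (Suc m))"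
    by (simp add: norm inner b_def mult_2[symmetric])
  have fin: "finite {x. v m x \<noteq> 0}" using fs[of m] by (simp add: fin_supp_def)
  have "(\<Sum>x | v m x \<noteq> 0. v m x) = measure (p m) {x. v m x \<noteq> 0} + measure (p (Suc m)) {x. v m x \<noteq> 0}"
    using fin by (simp add: v_def sum.distrib measure_measure_pmf_finite)
  also have "\<dots> \<le> 1 + 1" by (intro add_mono) simp_all
  finally show "(\<Sum>x | v m x \<noteq> 0. v m x) \<le> 2" by simp
qed

text \<open>
  Cutting off at a level proportional to the square norm keeps half of the norm, because
  \<open>f\<^sup>2 \<ge> v\<^sup>2 - 2 s v\<close> for \<open>f = max 0 (v - s)\<close> and the mass of \<open>v\<close> is at most 2, and leaves a support of
  controlled size by Markov's inequality.  Being a contraction, it does not raise the energy.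
\<close>

lemma truncation_at_an_eighth_of_sq_norm:
  assumes v: "fin_supp G v" "\<And>x. 0 \<le> v x" and mass: "(\<Sum>x | v x \<noteq> 0. v x) \<le> 2" and norm: "0 < sq_norm G v"
    and p: "prob_measure_on G p"
  defines "f x \<equiv> max 0 (v x - sq_norm G v / 8)"
  shows "fin_supp G f" and "sq_norm G v / 2 \<le> sq_norm G f"
    and "card {x. f x \<noteq> 0} \<le> 16 / sq_norm G v" and "dirichlet_energy G p f \<le> dirichlet_energy G p v"
proof -
  let ?s = "sq_norm G v / 8" and ?V = "{x. v x \<noteq> 0}"
  have s: "0 < ?s" using norm by simp
  have V: "finite ?V" "?V \<subseteq> carrier G" using v by (auto simp: fin_supp_def)
  have sub: "{x. f x \<noteq> 0} \<subseteq> ?V" using s by (auto simp: f_def)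
  show fs: "fin_supp G f" using V sub unfolding fin_supp_def by (meson finite_subset subset_trans)
  have "sq_norm G v - 2 * ?s * 2 \<le> (\<Sum>x\<in>?V. (v x)\<^sup>2) - 2 * ?s * (\<Sum>x\<in>?V. v x)"
    using mass s by (intro diff_mono mult_left_mono) (auto simp: sq_norm_eq_sum[OF v(1)])
  also have "\<dots> = (\<Sum>x\<in>?V. (v x)\<^sup>2 - 2 * ?s * v x)" by (simp add: sum_subtractf sum_distrib_left)
  also have "\<dots> \<le> (\<Sum>x\<in>?V. (f x)\<^sup>2)"
  proof (rule sum_mono)
    fix x
    show "(v x)\<^sup>2 - 2 * ?s * v x \<le> (f x)\<^sup>2"
    proof (cases "?s \<le> v x")
      case True
      then have "(f x)\<^sup>2 = (v x)\<^sup>2 - 2 * ?s * v x + ?s\<^sup>2" by (simp add: f_def power2_diff)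
      then show ?thesis by simp
    next
      case False
      then have "v x * (v x - 2 * ?s) \<le> 0" using v(2)[of x] s by (intro mult_nonneg_nonpos) auto
      then have "(v x)\<^sup>2 - 2 * ?s * v x \<le> 0" by (simp add: power2_eq_square algebra_simps)
      then show ?thesis using zero_le_power2[of "f x"] by linarith
    qed
  qed
  also have "\<dots> = sq_norm G f"
    unfolding sq_norm_eq_sum[OF fs] using V sub by (intro sum.mono_neutral_right) auto
  finally show "sq_norm G v / 2 \<le> sq_norm G f" by simp
  have "?s * card {x. f x \<noteq> 0} = (\<Sum>x | f x \<noteq> 0. ?s)" by simp
  also have "\<dots> \<le> (\<Sum>x | f x \<noteq> 0. v x)" by (intro sum_mono) (auto simp: f_def max_def split: if_splits)
  also have "\<dots> \<le> (\<Sum>x\<in>?V. v x)" using V sub v(2) by (intro sum_mono2) auto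
  also have "\<dots> \<le> 2" by (rule mass)
  finally show "card {x. f x \<noteq> 0} \<le> 16 / sq_norm G v" using norm by (simp add: field_simps)
  have "shift_energy G f z \<le> shift_energy G v z" if z: "z \<in> carrier G" for z
    unfolding shift_energy_def
  proof (rule infsum_mono)
    show "(\<lambda>x. (f x - f (x \<otimes> z))\<^sup>2) summable_on carrier G"
      using fs z by (intro summable_on_translates[of f "{z}"]) auto
    show "(\<lambda>x. (v x - v (x \<otimes> z))\<^sup>2) summable_on carrier G"
      using v z by (intro summable_on_translates[of v "{z}"]) auto
    show "(f x - f (x \<otimes> z))\<^sup>2 \<le> (v x - v (x \<otimes> z))\<^sup>2" for x
      unfolding abs_le_square_iff[symmetric] f_def by auto
  qed
  then show "dirichlet_energy G p f \<le> dirichlet_energy G p v"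
    unfolding dirichlet_energy_def
    using p integrable_shift_energy[OF fs p] integrable_shift_energy[OF v(1) p]
    by (intro integral_mono_AE) (auto simp: AE_measure_pmf_iff prob_measure_on_def)
qed

text \<open>
  A large return probability at time \<open>2 n\<close> leaves little room for decay, so the quotient of energy and norm of
  the convolution powers is small at some time \<open>m < n\<close>.  The norm at that time is still at least \<open>exp (- c)\<close>,
  hence truncation costs a support of size only \<open>16 exp c\<close>.
\<close>

lemma ex_small_energy_of_return_probability:
  assumes \<mu>: "prob_measure_on G \<mu>" "map_pmf (m_inv G) \<mu> = \<mu>" "finite (set_pmf \<mu>)"
    and n: "0 < n" and ret: "exp (- c) \<le> pmf (convolution_power G \<mu> (2 * n)) \<one>"
  shows "\<exists>f. fin_supp G f \<and> (\<forall>x. 0 \<le> f x) \<and> 0 < sq_norm G f \<and> card {x. f x \<noteq> 0} \<le> 16 * exp c \<and>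
             dirichlet_energy G \<mu> f \<le> 4 * ((c + ln 2) / n) * sq_norm G f"
proof -
  let ?p = "convolution_power G \<mu>"
  define v where "v m x = pmf (?p m) x + pmf (?p (Suc m)) x" for m x
  define b where "b m = pmf (?p (2 * m)) \<one> + pmf (?p (Suc (2 * m))) \<one>" for m
  note vb = consecutive_convolution_powers[OF \<mu>, folded v_def b_def]
  have b_pos: "0 \<le> b m" for m by (simp add: b_def)
  have b_dec: "b (Suc m) \<le> b m" for m
  proof -
    have "0 \<le> dirichlet_energy G \<mu> (v m)"
      unfolding dirichlet_energy_def by (intro integral_nonneg_AE) (simp add: shift_energy_nonneg)
    then show ?thesis by (simp add: vb(3))
  qed
  have b0: "0 < b 0" "b 0 \<le> 2" using pmf_le_1[of \<mu> \<one>] \<mu>(1)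
    by (auto simp: b_def convolution_pmf_one_left intro: add_pos_nonneg)
  have bn: "exp (- c) \<le> b n" using ret pmf_nonneg[of "?p (Suc (2 * n))" \<one>] unfolding b_def by linarith
  obtain m where m: "m < n" and step: "b m - b (Suc m) \<le> (c + ln 2) / n * b m"
    using ex_small_relative_decrement[of n b c, OF n b0 b_pos bn] by blast
  have "b n \<le> b m" by (rule lift_Suc_antimono_le[of b, OF b_dec]) (use m in simp)
  then have norm: "exp (- c) \<le> sq_norm G (v m)" using bn vb(2)[of m] by linarith
  then have norm_pos: "0 < sq_norm G (v m)" by (rule less_le_trans[OF exp_gt_zero])
  have v_nonneg: "0 \<le> v m x" for x by (simp add: v_def)
  define f where "f x = max 0 (v m x - sq_norm G (v m) / 8)" for x
  note tr = truncation_at_an_eighth_of_sq_norm[OF vb(1) v_nonneg vb(4) norm_pos \<mu>(1), folded f_def]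
  have l: "0 \<le> (c + ln 2) / n"
  proof -
    have "0 \<le> (c + ln 2) / n * b m" using step b_dec[of m] by linarith
    moreover have "0 < b m" using bn \<open>b n \<le> b m\<close> exp_gt_zero[of "- c"] by linarith
    ultimately show ?thesis unfolding zero_le_mult_iff by linarith
  qed
  show ?thesis
  proof (intro exI[of _ f] conjI allI)
    show "fin_supp G f" by (rule tr)
    show "0 \<le> f x" for x by (simp add: f_def)
    show "0 < sq_norm G f" using tr(2) norm_pos by linarith
    have "16 / sq_norm G (v m) \<le> 16 / exp (- c)" using norm norm_pos by (intro divide_left_mono) auto
    then show "card {x. f x \<noteq> 0} \<le> 16 * exp c" using tr(3) by (simp add: exp_minus field_simps)
    have "dirichlet_energy G \<mu> f \<le> 2 * (b m - b (Suc m))" using tr(4) by (simp add: vb(3))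
    also have "\<dots> \<le> 2 * ((c + ln 2) / n * sq_norm G (v m))"
      using step l vb(2)[of m] by (meson mult_left_mono order_trans zero_le_numeral)
    also have "\<dots> \<le> 2 * ((c + ln 2) / n * (2 * sq_norm G f))"
      using tr(2) l by (intro mult_left_mono) auto
    also have "\<dots> = 4 * ((c + ln 2) / n) * sq_norm G f" by (simp only: mult_ac) simp
    finally show "dirichlet_energy G \<mu> f \<le> 4 * ((c + ln 2) / n) * sq_norm G f" .
  qed
qed

end

section \<open>Transfer along a quasi-isometry\<close>

lemma infsum_le_of_bounded_fibres:
  fixes w :: "'a \<Rightarrow> real"
  assumes A: "finite A" "A \<subseteq> X" and w: "\<And>x. x \<in> X \<Longrightarrow> x \<notin> A \<Longrightarrow> w x = 0" "\<And>x. 0 \<le> w x"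
    and \<psi>: "\<And>y. y \<in> Y \<Longrightarrow> \<psi> y \<in> X"
    and fibre: "\<And>x. x \<in> X \<Longrightarrow> finite {y \<in> Y. \<psi> y = x} \<and> card {y \<in> Y. \<psi> y = x} \<le> N"
  shows "(\<lambda>y. w (\<psi> y)) summable_on Y" and "(\<Sum>\<^sub>\<infinity>y\<in>Y. w (\<psi> y)) \<le> real N * (\<Sum>\<^sub>\<infinity>x\<in>X. w x)"
proof -
  define P where "P = (\<Union>x\<in>A. {y \<in> Y. \<psi> y = x})"
  have P: "finite P" "P \<subseteq> Y" using A fibre by (auto simp: P_def subset_iff)
  have out: "w (\<psi> y) = 0" if "y \<in> Y" "y \<notin> P" for y
    using that \<psi>[of y] w(1)[of "\<psi> y"] by (auto simp: P_def)
  show "(\<lambda>y. w (\<psi> y)) summable_on Y" by (rule infsum_carrier_finite(2)[OF P out])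
  have "(\<Sum>\<^sub>\<infinity>y\<in>Y. w (\<psi> y)) = (\<Sum>y\<in>P. w (\<psi> y))" by (rule infsum_carrier_finite(1)[OF P out])
  also have "\<dots> = (\<Sum>x\<in>A. \<Sum>y\<in>{y \<in> Y. \<psi> y = x}. w (\<psi> y))"
    unfolding P_def using A fibre by (intro sum.UNION_disjoint) (auto simp: subset_iff)
  also have "\<dots> = (\<Sum>x\<in>A. real (card {y \<in> Y. \<psi> y = x}) * w x)" by simp
  also have "\<dots> \<le> (\<Sum>x\<in>A. real N * w x)"
    using A fibre w(2) by (intro sum_mono mult_right_mono) auto
  also have "\<dots> = real N * (\<Sum>\<^sub>\<infinity>x\<in>X. w x)"
    using infsum_carrier_finite(1)[OF A w(1)] by (simp add: sum_distrib_left)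
  finally show "(\<Sum>\<^sub>\<infinity>y\<in>Y. w (\<psi> y)) \<le> real N * (\<Sum>\<^sub>\<infinity>x\<in>X. w x)" .
qed

text \<open>
  The function \<open>f\<close> is pulled back to \<open>F y = f (\<phi> y \<otimes> g)\<close>.  The fibres of \<open>\<phi>\<close> are bounded, so the support grows
  at most by a constant factor, and a step \<open>s \<in> S'\<close> in \<open>H\<close> becomes one of finitely many steps in \<open>G\<close>, so the
  energy does too.  The image of \<open>\<phi>\<close> may miss the places where \<open>f\<close> is large; as it is coarsely dense, it
  meets them after one of finitely many right translations \<open>g\<close>, and one such \<open>g\<close> recovers a fixed proportion
  of the norm.
\<close>

lemma quasi_isometry_transfers_energy:
  fixes G :: "('a, 'm) monoid_scheme" and H :: "('b, 'n) monoid_scheme"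
  assumes "word_metric H S" and "word_metric G T"
    and qi: "quasi_isometry (carrier H) (word_dist H S) (carrier G) (word_dist G T) \<phi>"
    and \<mu>: "prob_measure_on G \<mu>" "generating_support G \<mu>"
    and S': "finite S'" "S' \<subseteq> carrier H"
  shows "\<exists>C::real. 1 \<le> C \<and> (\<forall>f. fin_supp G f \<longrightarrow> (\<forall>x. 0 \<le> f x) \<longrightarrow>
     (\<exists>F. fin_supp H F \<and> (\<forall>y. 0 \<le> F y) \<and> real (card {y. F y \<noteq> 0}) \<le> C * card {x. f x \<noteq> 0} \<and>
          sq_norm G f \<le> C * sq_norm H F \<and> (\<forall>s\<in>S'. shift_energy H F s \<le> C * dirichlet_energy G \<mu> f)))"
proof -
  interpret H: word_metric H S by fact
  interpret G: word_metric G T by fact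
  have \<phi>: "\<phi> y \<in> carrier G" if "y \<in> carrier H" for y
    using qi that by (auto simp: quasi_isometry_def)
  obtain A B C0 where A: "1 \<le> A" and B: "0 \<le> B" and C0: "0 \<le> C0"
    and lower: "\<And>y z. y \<in> carrier H \<Longrightarrow> z \<in> carrier H \<Longrightarrow> word_dist H S y z / A - B \<le> word_dist G T (\<phi> y) (\<phi> z)"
    and upper: "\<And>y z. y \<in> carrier H \<Longrightarrow> z \<in> carrier H \<Longrightarrow> word_dist G T (\<phi> y) (\<phi> z) \<le> A * word_dist H S y z + B"
    and dense: "\<And>x. x \<in> carrier G \<Longrightarrow> \<exists>y\<in>carrier H. word_dist G T (\<phi> y) x \<le> C0"
    using qi unfolding quasi_isometry_def by metis
  define ball_H where "ball_H = {h \<in> carrier H. H.wl h \<le> nat \<lceil>A * B\<rceil>}"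
  define N where "N = card ball_H"
  have fibre: "finite {y \<in> carrier H. \<phi> y = x} \<and> card {y \<in> carrier H. \<phi> y = x} \<le> N" for x
  proof (cases "{y \<in> carrier H. \<phi> y = x} = {}")
    case False
    then obtain y0 where y0: "y0 \<in> carrier H" "\<phi> y0 = x" by blast
    have sub: "{y \<in> carrier H. \<phi> y = x} \<subseteq> (\<lambda>h. y0 \<otimes>\<^bsub>H\<^esub> h) ` ball_H"
    proof
      fix y assume "y \<in> {y \<in> carrier H. \<phi> y = x}"
      then have y: "y \<in> carrier H" "\<phi> y = x" by auto
      let ?h = "inv\<^bsub>H\<^esub> y0 \<otimes>\<^bsub>H\<^esub> y"
      have "word_dist H S y0 y / A - B \<le> word_dist G T x x" using lower[OF y0(1) y(1)] y0 y by simp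
      also have "\<dots> = 0" using \<phi>[OF y(1)] y(2) by (auto simp: word_dist_def G.word_length_one)
      finally have "word_dist H S y0 y \<le> A * B" using A by (simp add: field_simps)
      then have "?h \<in> ball_H" using y0 y by (simp add: ball_H_def word_dist_def) linarith
      moreover have "y = y0 \<otimes>\<^bsub>H\<^esub> ?h" using y0 y by (simp add: H.m_assoc[symmetric])
      ultimately show "y \<in> (\<lambda>h. y0 \<otimes>\<^bsub>H\<^esub> h) ` ball_H" by blast
    qed
    have fin: "finite ball_H" unfolding ball_H_def by (rule H.finite_word_ball)
    have "card {y \<in> carrier H. \<phi> y = x} \<le> card ((\<lambda>h. y0 \<otimes>\<^bsub>H\<^esub> h) ` ball_H)"
      using fin sub by (intro card_mono) auto
    also have "\<dots> \<le> N" unfolding N_def using fin by (rule card_image_le)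
    finally show ?thesis using fin sub finite_subset by blast
  next
    case True
    show ?thesis unfolding True by simp
  qed
  define D where "D = {g \<in> carrier G. G.wl g \<le> nat \<lceil>C0\<rceil>}"
  have D: "finite D" "D \<subseteq> carrier G" unfolding D_def by (rule G.finite_word_ball) auto
  have D_one: "\<one>\<^bsub>G\<^esub> \<in> D" by (simp add: D_def G.word_length_one)
  have cover: "\<exists>y\<in>carrier H. \<exists>g\<in>D. \<phi> y \<otimes>\<^bsub>G\<^esub> g = x" if x: "x \<in> carrier G" for x
  proof -
    obtain y where y: "y \<in> carrier H" "word_dist G T (\<phi> y) x \<le> C0" using dense[OF x] by blast
    have "inv\<^bsub>G\<^esub> (\<phi> y) \<otimes>\<^bsub>G\<^esub> x \<in> D"
      using y x \<phi>[OF y(1)] by (simp add: D_def word_dist_def) linarith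
    moreover have "\<phi> y \<otimes>\<^bsub>G\<^esub> (inv\<^bsub>G\<^esub> (\<phi> y) \<otimes>\<^bsub>G\<^esub> x) = x"
      using x \<phi>[OF y(1)] by (simp add: G.m_assoc[symmetric])
    ultimately show ?thesis using y by blast
  qed
  define R where "R = (\<Sum>s\<in>S'. H.wl s)"
  define ball_G where "ball_G = {h \<in> carrier G. G.wl h \<le> nat \<lceil>A * R + B\<rceil>}"
  have ball_G: "finite ball_G" "ball_G \<subseteq> carrier G" unfolding ball_G_def by (rule G.finite_word_ball) auto
  have step: "inv\<^bsub>G\<^esub> (\<phi> y) \<otimes>\<^bsub>G\<^esub> \<phi> (y \<otimes>\<^bsub>H\<^esub> s) \<in> ball_G" if y: "y \<in> carrier H" and s: "s \<in> S'" for y s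
  proof -
    have sH: "s \<in> carrier H" using s S' by blast
    have "inv\<^bsub>H\<^esub> y \<otimes>\<^bsub>H\<^esub> (y \<otimes>\<^bsub>H\<^esub> s) = s" using y sH by (simp add: H.m_assoc[symmetric])
    then have "word_dist H S y (y \<otimes>\<^bsub>H\<^esub> s) \<le> R"
      using member_le_sum[of s S' "\<lambda>s. real (H.wl s)"] s S' by (simp add: word_dist_def R_def)
    then have "A * word_dist H S y (y \<otimes>\<^bsub>H\<^esub> s) + B \<le> A * R + B" using A by (simp add: mult_left_mono)
    then have "word_dist G T (\<phi> y) (\<phi> (y \<otimes>\<^bsub>H\<^esub> s)) \<le> A * R + B"
      using upper[of y "y \<otimes>\<^bsub>H\<^esub> s"] y sH by (meson H.m_closed order_trans)
    then show ?thesis using \<phi> y sH by (simp add: ball_G_def word_dist_def) linarith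
  qed
  \<comment> \<open>Moving \<open>g\<close> past a step conjugates the step.\<close>
  define steps where "steps = (\<lambda>(g, b). inv\<^bsub>G\<^esub> g \<otimes>\<^bsub>G\<^esub> b \<otimes>\<^bsub>G\<^esub> g) ` (D \<times> ball_G)"
  have steps: "finite steps" "steps \<subseteq> carrier G" using D ball_G by (auto simp: steps_def)
  have "\<forall>h\<in>steps. \<exists>c\<ge>0. \<forall>f. fin_supp G f \<longrightarrow> shift_energy G f h \<le> c * dirichlet_energy G \<mu> f"
    using G.ex_shift_energy_le_dirichlet_energy[OF \<mu>] steps by blast
  then obtain c where c: "\<And>h. h \<in> steps \<Longrightarrow> 0 \<le> c h"
    "\<And>h f. h \<in> steps \<Longrightarrow> fin_supp G f \<Longrightarrow> shift_energy G f h \<le> c h * dirichlet_energy G \<mu> f" by metis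
  define L where "L = real N * (\<Sum>h\<in>steps. c h)"
  have L: "0 \<le> L" using c(1) by (simp add: L_def sum_nonneg)
  define C where "C = 1 + real N + real (card D) + L"
  have C: "1 \<le> C" "real N \<le> C" "real (card D) \<le> C" "L \<le> C" using L by (simp_all add: C_def)
  show ?thesis
  proof (intro exI[of _ C] conjI allI impI)
    fix f assume f: "fin_supp G f" and f_nonneg: "\<forall>x. 0 \<le> f x"
    let ?U = "{x. f x \<noteq> 0}"
    have U: "finite ?U" "?U \<subseteq> carrier G" using f by (auto simp: fin_supp_def)
    define F where "F g y = (if y \<in> carrier H then f (\<phi> y \<otimes>\<^bsub>G\<^esub> g) else 0)" for g y
    have fibre_g: "finite {y \<in> carrier H. \<phi> y \<otimes>\<^bsub>G\<^esub> g = x} \<and> card {y \<in> carrier H. \<phi> y \<otimes>\<^bsub>G\<^esub> g = x} \<le> N"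
      if g: "g \<in> carrier G" and x: "x \<in> carrier G" for g x
    proof -
      have "{y \<in> carrier H. \<phi> y \<otimes>\<^bsub>G\<^esub> g = x} = {y \<in> carrier H. \<phi> y = x \<otimes>\<^bsub>G\<^esub> inv\<^bsub>G\<^esub> g}"
        using g x \<phi> by (auto simp: G.m_assoc)
      then show ?thesis using fibre by simp
    qed
    have supp: "{y. F g y \<noteq> 0} = (\<Union>x\<in>?U. {y \<in> carrier H. \<phi> y \<otimes>\<^bsub>G\<^esub> g = x})" for g
      by (auto simp: F_def split: if_splits)
    have F_fs: "fin_supp H (F g)" if "g \<in> carrier G" for g
      unfolding fin_supp_def supp using U fibre_g[OF that] by auto
    have F_card: "card {y. F g y \<noteq> 0} \<le> N * card ?U" if g: "g \<in> carrier G" for g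
    proof -
      have "card {y. F g y \<noteq> 0} \<le> (\<Sum>x\<in>?U. card {y \<in> carrier H. \<phi> y \<otimes>\<^bsub>G\<^esub> g = x})"
        unfolding supp by (rule card_UN_le[OF U(1)])
      also have "\<dots> \<le> (\<Sum>x\<in>?U. N)" using fibre_g[OF g] U(2) by (intro sum_mono) blast
      finally show ?thesis by (simp add: mult.commute)
    qed
    have F_energy: "shift_energy H (F g) s \<le> L * dirichlet_energy G \<mu> f" if g: "g \<in> D" and s: "s \<in> S'" for g s
    proof -
      have gG: "g \<in> carrier G" and sH: "s \<in> carrier H" using g s D S' by auto
      let ?\<psi> = "\<lambda>y. \<phi> y \<otimes>\<^bsub>G\<^esub> g"
      define w where "w x = (if x \<in> carrier G then \<Sum>h\<in>steps. (f x - f (x \<otimes>\<^bsub>G\<^esub> h))\<^sup>2 else 0)" for x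
      define P where "P = ?U \<union> (\<Union>h\<in>steps. {x \<in> carrier G. f (x \<otimes>\<^bsub>G\<^esub> h) \<noteq> 0})"
      have P: "finite P" "P \<subseteq> carrier G"
        unfolding P_def using U steps G.finite_translated_support[OF f] by auto
      have w0: "w x = 0" if "x \<in> carrier G" "x \<notin> P" for x
        using that by (auto simp: w_def P_def intro!: sum.neutral)
      have w_nonneg: "0 \<le> w x" for x by (simp add: w_def sum_nonneg)
      note fib = infsum_le_of_bounded_fibres[where \<psi> = ?\<psi> and w = w and A = P and X = "carrier G" and Y = "carrier H" and N = N,
          OF P w0 w_nonneg]
      have \<psi>_closed: "?\<psi> y \<in> carrier G" if "y \<in> carrier H" for y using \<phi>[OF that] gG by simp
      have "shift_energy H (F g) s \<le> (\<Sum>\<^sub>\<infinity>y\<in>carrier H. w (?\<psi> y))"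
        unfolding shift_energy_def
      proof (rule infsum_mono)
        show "(\<lambda>y. (F g y - F g (y \<otimes>\<^bsub>H\<^esub> s))\<^sup>2) summable_on carrier H"
          using F_fs[OF gG] sH by (intro H.summable_on_translates[of "F g" "{s}"]) auto
        show "(\<lambda>y. w (?\<psi> y)) summable_on carrier H"
          by (rule fib(1)) (use \<psi>_closed fibre_g[OF gG] in auto)
        fix y assume y: "y \<in> carrier H"
        let ?b = "inv\<^bsub>G\<^esub> (\<phi> y) \<otimes>\<^bsub>G\<^esub> \<phi> (y \<otimes>\<^bsub>H\<^esub> s)"
        let ?h = "inv\<^bsub>G\<^esub> g \<otimes>\<^bsub>G\<^esub> ?b \<otimes>\<^bsub>G\<^esub> g"
        have b: "?b \<in> ball_G" by (rule step[OF y s])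
        then have h: "?h \<in> steps" unfolding steps_def using g by (intro image_eqI[of _ _ "(g, ?b)"]) auto
        have bG: "?b \<in> carrier G" using b ball_G by blast
        have \<phi>y: "\<phi> y \<in> carrier G" "\<phi> (y \<otimes>\<^bsub>H\<^esub> s) \<in> carrier G" using \<phi> y sH by auto
        have "?\<psi> y \<otimes>\<^bsub>G\<^esub> ?h = \<phi> y \<otimes>\<^bsub>G\<^esub> (g \<otimes>\<^bsub>G\<^esub> inv\<^bsub>G\<^esub> g) \<otimes>\<^bsub>G\<^esub> ?b \<otimes>\<^bsub>G\<^esub> g"
          using \<phi>y gG bG by (simp only: G.m_assoc G.m_closed G.inv_closed)
        also have "\<dots> = \<phi> y \<otimes>\<^bsub>G\<^esub> ?b \<otimes>\<^bsub>G\<^esub> g" using \<phi>y gG bG by simp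
        also have "\<phi> y \<otimes>\<^bsub>G\<^esub> ?b = \<phi> (y \<otimes>\<^bsub>H\<^esub> s)" using \<phi>y by (simp add: G.m_assoc[symmetric])
        finally have \<psi>_step: "?\<psi> y \<otimes>\<^bsub>G\<^esub> ?h = \<phi> (y \<otimes>\<^bsub>H\<^esub> s) \<otimes>\<^bsub>G\<^esub> g" .
        have "(F g y - F g (y \<otimes>\<^bsub>H\<^esub> s))\<^sup>2 = (f (?\<psi> y) - f (?\<psi> y \<otimes>\<^bsub>G\<^esub> ?h))\<^sup>2"
          unfolding \<psi>_step using y sH by (simp add: F_def)
        also have "\<dots> \<le> (\<Sum>h\<in>steps. (f (?\<psi> y) - f (?\<psi> y \<otimes>\<^bsub>G\<^esub> h))\<^sup>2)"
          by (rule member_le_sum[OF h, of "\<lambda>h. (f (?\<psi> y) - f (?\<psi> y \<otimes>\<^bsub>G\<^esub> h))\<^sup>2"]) (use steps in auto)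
        also have "\<dots> = w (?\<psi> y)" using \<psi>_closed[OF y] by (simp add: w_def)
        finally show "(F g y - F g (y \<otimes>\<^bsub>H\<^esub> s))\<^sup>2 \<le> w (?\<psi> y)" .
      qed
      also have "\<dots> \<le> real N * (\<Sum>\<^sub>\<infinity>x\<in>carrier G. w x)"
        by (rule fib(2)) (use \<psi>_closed fibre_g[OF gG] in auto)
      also have "(\<Sum>\<^sub>\<infinity>x\<in>carrier G. w x) = (\<Sum>x\<in>P. w x)"
        by (rule infsum_carrier_finite(1)[OF P]) (rule w0)
      also have "\<dots> = (\<Sum>x\<in>P. \<Sum>h\<in>steps. (f x - f (x \<otimes>\<^bsub>G\<^esub> h))\<^sup>2)"
        using P(2) by (intro sum.cong) (auto simp: w_def)
      also have "\<dots> = (\<Sum>h\<in>steps. \<Sum>x\<in>P. (f x - f (x \<otimes>\<^bsub>G\<^esub> h))\<^sup>2)" by (rule sum.swap)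
      also have "\<dots> = (\<Sum>h\<in>steps. shift_energy G f h)"
        unfolding shift_energy_def
        by (intro sum.cong refl infsum_carrier_finite(1)[symmetric] P) (auto simp: P_def)
      also have "\<dots> \<le> (\<Sum>h\<in>steps. c h * dirichlet_energy G \<mu> f)" using c(2) f by (intro sum_mono) auto
      finally show ?thesis by (simp add: L_def sum_distrib_right[symmetric] mult_left_mono)
    qed
    have "\<exists>g\<in>D. sq_norm G f \<le> card D * sq_norm H (F g)"
    proof (rule ccontr)
      assume "\<not> ?thesis"
      then have less: "card D * sq_norm H (F g) < sq_norm G f" if "g \<in> D" for g using that by (auto simp: not_le)
      obtain yy gg where yg: "\<And>x. x \<in> ?U \<Longrightarrow> yy x \<in> carrier H \<and> gg x \<in> D \<and> \<phi> (yy x) \<otimes>\<^bsub>G\<^esub> gg x = x"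
        using cover U(2) by (metis subsetD)
      let ?pairs = "Sigma D (\<lambda>g. {y. F g y \<noteq> 0})"
      have "sq_norm G f = (\<Sum>x\<in>?U. (F (gg x) (yy x))\<^sup>2)"
        unfolding sq_norm_eq_sum[OF f] using yg by (intro sum.cong refl) (simp add: F_def)
      also have "\<dots> = (\<Sum>p\<in>(\<lambda>x. (gg x, yy x)) ` ?U. (F (fst p) (snd p))\<^sup>2)"
      proof (subst sum.reindex)
        show "inj_on (\<lambda>x. (gg x, yy x)) ?U" by (rule inj_onI) (metis prod.inject yg)
      qed simp
      also have "\<dots> \<le> (\<Sum>p\<in>?pairs. (F (fst p) (snd p))\<^sup>2)"
      proof (rule sum_mono2)
        show "finite ?pairs" using D F_fs by (auto simp: fin_supp_def)
        show "(\<lambda>x. (gg x, yy x)) ` ?U \<subseteq> ?pairs" using yg by (auto simp: F_def)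
      qed simp
      also have "\<dots> = (\<Sum>g\<in>D. sq_norm H (F g))"
        using D F_fs by (subst sum.Sigma[symmetric, of D "\<lambda>g. {y. F g y \<noteq> 0}" "\<lambda>g y. (F g y)\<^sup>2", simplified case_prod_beta'])
          (auto simp: fin_supp_def sq_norm_eq_sum intro!: sum.cong)
      finally have le: "sq_norm G f \<le> (\<Sum>g\<in>D. sq_norm H (F g))" .
      have card_D: "0 < card D" using D D_one by (auto simp: card_gt_0_iff)
      have "card D * (\<Sum>g\<in>D. sq_norm H (F g)) < (\<Sum>g\<in>D. sq_norm G f)"
        unfolding sum_distrib_left using D D_one less by (intro sum_strict_mono) auto
      then show False using le card_D by simp
    qed
    then obtain g where g: "g \<in> D" and norm: "sq_norm G f \<le> card D * sq_norm H (F g)" by blast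
    have gG: "g \<in> carrier G" using g D by blast
    have norm_nonneg: "0 \<le> sq_norm H (F g)" unfolding sq_norm_def by (intro infsum_nonneg) simp
    have energy_nonneg: "0 \<le> dirichlet_energy G \<mu> f"
      unfolding dirichlet_energy_def by (intro integral_nonneg_AE) (simp add: G.shift_energy_nonneg)
    show "\<exists>F. fin_supp H F \<and> (\<forall>y. 0 \<le> F y) \<and> real (card {y. F y \<noteq> 0}) \<le> C * card ?U \<and>
          sq_norm G f \<le> C * sq_norm H F \<and> (\<forall>s\<in>S'. shift_energy H F s \<le> C * dirichlet_energy G \<mu> f)"
    proof (intro exI[of _ "F g"] conjI ballI allI)
      show "fin_supp H (F g)" by (rule F_fs[OF gG])
      show "0 \<le> F g y" for y using f_nonneg by (simp add: F_def)
      have "real (card {y. F g y \<noteq> 0}) \<le> real N * real (card ?U)"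
        using F_card[OF gG] by (simp flip: of_nat_mult)
      also have "\<dots> \<le> C * card ?U" using C by (intro mult_right_mono) auto
      finally show "card {y. F g y \<noteq> 0} \<le> C * card ?U" .
      show "sq_norm G f \<le> C * sq_norm H (F g)"
        using norm mult_right_mono[OF C(3) norm_nonneg] by linarith
      show "shift_energy H (F g) s \<le> C * dirichlet_energy G \<mu> f" if "s \<in> S'" for s
        using F_energy[OF g that] mult_right_mono[OF C(4) energy_nonneg] by linarith
    qed
  qed (rule C)
qed

section \<open>Slow decay of return probabilities\<close>

theorem corollary1p2:
  fixes G :: "('a, 'm) monoid_scheme" and \<Gamma> :: "('b, 'n) monoid_scheme"
    and \<mu> :: "'a pmf" and \<gamma> :: "real \<Rightarrow> real" and \<eta> :: "'b pmf"
  assumes "group G" and "finitely_generated G" and "infinite (carrier G)"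
    and "prob_measure_on G \<mu>" and "symmetric_pmf G \<mu>" and "finite_generating_support G \<mu>"
    and "\<And>t. t \<ge> 1 \<Longrightarrow> \<gamma> t > 0"
    and "\<not> bounded (\<gamma> ` {1..})"
    and "mono_on {1..} \<gamma>"
    and "mono_on {1..} (\<lambda>t. sqrt t / \<gamma> t)"
    and "((\<lambda>t. \<gamma> t / sqrt t) \<longlongrightarrow> 0) at_top"
    and "\<And>n::nat. n \<ge> 1 \<Longrightarrow> pmf (convolution_power G \<mu> (2 * n)) \<one>\<^bsub>G\<^esub> \<ge> exp (- \<gamma> (real n))"
    and "group \<Gamma>" and "finitely_generated \<Gamma>"
    and "quasi_isometric_groups \<Gamma> G"
    and "prob_measure_on \<Gamma> \<eta>" and "symmetric_pmf \<Gamma> \<eta>" and "finite_second_moment \<Gamma> \<eta>"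
    and "generating_support \<Gamma> \<eta>"
  shows "liouville_property \<Gamma> \<eta>"
proof -
  interpret G: group G by fact
  interpret \<Gamma>: group \<Gamma> by fact
  obtain S T \<phi> where S: "finite_generating_set \<Gamma> S" and T: "finite_generating_set G T"
    and qi: "quasi_isometry (carrier \<Gamma>) (word_dist \<Gamma> S) (carrier G) (word_dist G T) \<phi>"
    using assms(15) by (auto simp: quasi_isometric_groups_def)
  obtain S' where S': "finite_generating_set \<Gamma> S'"
    and moment: "(\<lambda>g. (real (word_length \<Gamma> S' g))\<^sup>2 * pmf \<eta> g) summable_on carrier \<Gamma>"
    using assms(18) by (auto simp: finite_second_moment_def)
  interpret W: word_metric \<Gamma> S' by unfold_locales (rule S')
  have wm: "word_metric \<Gamma> S" "word_metric G T" using S T by unfold_locales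
  have S'_fin: "finite S'" "S' \<subseteq> carrier \<Gamma>" using S' by (auto simp: finite_generating_set_def)
  have \<mu>: "prob_measure_on G \<mu>" "map_pmf (m_inv G) \<mu> = \<mu>" "finite (set_pmf \<mu>)" "generating_support G \<mu>"
    using assms(4,6) symmetric_pmf_map_inv[OF assms(1,4,5)] by (auto simp: finite_generating_support_def)
  have \<eta>: "prob_measure_on \<Gamma> \<eta>" "map_pmf (m_inv \<Gamma>) \<eta> = \<eta>"
    using assms(16) symmetric_pmf_map_inv[OF assms(13,16,17)] by auto
  have int: "integrable (measure_pmf \<eta>) (\<lambda>g. (real (W.wl g))\<^sup>2)"
    by (rule W.integrable_word_length_square[OF \<eta>(1) moment])
  define M where "M = (\<integral>g. (real (W.wl g))\<^sup>2 \<partial>\<eta>)"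
  have M: "0 \<le> M" by (simp add: M_def integral_nonneg_AE)
  obtain C :: real where C: "1 \<le> C" and transfer: "\<And>f. fin_supp G f \<Longrightarrow> \<forall>x. 0 \<le> f x \<Longrightarrow>
     \<exists>F. fin_supp \<Gamma> F \<and> (\<forall>y. 0 \<le> F y) \<and> real (card {y. F y \<noteq> 0}) \<le> C * card {x. f x \<noteq> 0} \<and>
          sq_norm G f \<le> C * sq_norm \<Gamma> F \<and> (\<forall>s\<in>S'. shift_energy \<Gamma> F s \<le> C * dirichlet_energy G \<mu> f)"
    using quasi_isometry_transfers_energy[OF wm qi \<mu>(1,4) S'_fin] by blast
  show ?thesis
  proof (rule W.liouville_if_concentrated[OF \<eta>(1) assms(19) int])
    \<comment> \<open>The function is built for \<open>n = 4 ^ k\<close> and the walk is run up to the time \<open>2 ^ k\<close>, the root of \<open>n\<close>.\<close>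
    fix \<delta> :: real assume \<delta>: "0 < \<delta>"
    have tail: "(\<lambda>k::nat. a * (\<gamma> (4 ^ k) + b) / 2 ^ k) \<longlonglongrightarrow> 0" for a b
    proof -
      have "filterlim (\<lambda>k::nat. 4 ^ k :: real) at_top sequentially"
        by (rule filterlim_at_infinity_imp_filterlim_at_top[OF filterlim_realpow_sequentially_gt1]) simp_all
      then have "(\<lambda>k. \<gamma> (4 ^ k) / sqrt (4 ^ k)) \<longlonglongrightarrow> 0"
        by (rule filterlim_compose[OF assms(11)])
      moreover have "sqrt (4 ^ k) = 2 ^ k" for k by (simp add: real_sqrt_power)
      ultimately have 1: "(\<lambda>k. \<gamma> (4 ^ k) / 2 ^ k) \<longlonglongrightarrow> 0" by simp
      have 2: "(\<lambda>k. (1 / 2) ^ k :: real) \<longlonglongrightarrow> 0" by (rule LIMSEQ_realpow_zero) auto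
      have "(\<lambda>k. a * (\<gamma> (4 ^ k) / 2 ^ k + b * (1 / 2) ^ k)) \<longlonglongrightarrow> a * (0 + b * 0)"
        by (intro tendsto_intros 1 2)
      moreover have "a * (\<gamma> (4 ^ k) / 2 ^ k + b * (1 / 2) ^ k) = a * (\<gamma> (4 ^ k) + b) / 2 ^ k" for k
        by (simp add: power_divide add_divide_distrib distrib_left)
      ultimately show ?thesis by simp
    qed
    have ev: "\<forall>\<^sub>F k in sequentially. a * (\<gamma> (4 ^ k) + b) / 2 ^ k < d" if "0 < d" for a b d
      by (rule order_tendstoD(2)[OF tail that])
    have "\<forall>\<^sub>F k in sequentially. 4 * M * C\<^sup>2 * (\<gamma> (4 ^ k) + ln 2) / 2 ^ k < 2 * \<delta>\<^sup>2 \<and>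
        1 * (\<gamma> (4 ^ k) + ln (16 * C)) / 2 ^ k < \<delta> \<and> 1 * (\<gamma> (4 ^ k) + 1) / 2 ^ k < \<delta>"
      using \<delta> by (intro eventually_conj ev) auto
    from eventually_happens'[OF sequentially_bot this] obtain k :: nat where k1: "4 * M * C\<^sup>2 * (\<gamma> (4 ^ k) + ln 2) / 2 ^ k < 2 * \<delta>\<^sup>2"
      and k2: "(\<gamma> (4 ^ k) + ln (16 * C)) / 2 ^ k < \<delta>" and k3: "(\<gamma> (4 ^ k) + 1) / 2 ^ k < \<delta>"
      by auto
    have \<gamma>_pos: "0 < \<gamma> (4 ^ k)" by (rule assms(7)) simp
    have k3': "1 \<le> \<delta> * 2 ^ k" using k3 \<gamma>_pos by (simp add: field_simps)
    obtain f where f: "fin_supp G f" "\<forall>x. 0 \<le> f x" "0 < sq_norm G f"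
      "card {x. f x \<noteq> 0} \<le> 16 * exp (\<gamma> (4 ^ k))"
      "dirichlet_energy G \<mu> f \<le> 4 * ((\<gamma> (4 ^ k) + ln 2) / 4 ^ k) * sq_norm G f"
      using G.ex_small_energy_of_return_probability[OF \<mu>(1-3), of "4 ^ k" "\<gamma> (4 ^ k)"]
        assms(12)[of "4 ^ k"] by auto
    obtain F where F: "fin_supp \<Gamma> F" "\<And>y. 0 \<le> F y" and F_card: "real (card {y. F y \<noteq> 0}) \<le> C * card {x. f x \<noteq> 0}"
      and F_norm: "sq_norm G f \<le> C * sq_norm \<Gamma> F"
      and F_energy: "\<And>s. s \<in> S' \<Longrightarrow> shift_energy \<Gamma> F s \<le> C * dirichlet_energy G \<mu> f"
      using transfer[OF f(1,2)] by blast
    have F_pos: "0 < sq_norm \<Gamma> F"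
    proof -
      have "0 < C * sq_norm \<Gamma> F" using f(3) F_norm by linarith
      then show ?thesis using C by (simp add: zero_less_mult_iff)
    qed
    define l where "l = (\<gamma> (4 ^ k) + ln 2) / 4 ^ k"
    have l: "0 \<le> l" using \<gamma>_pos by (simp add: l_def)
    have "dirichlet_energy \<Gamma> \<eta> F \<le> M * (C * dirichlet_energy G \<mu> f)"
      unfolding M_def by (rule W.dirichlet_energy_le_second_moment[OF F(1) F_energy \<eta>(1) int])
    also have "\<dots> \<le> M * (C * (4 * l * (C * sq_norm \<Gamma> F)))"
    proof -
      have "4 * l * sq_norm G f \<le> 4 * l * (C * sq_norm \<Gamma> F)"
        using l F_norm by (intro mult_left_mono) auto
      then have "dirichlet_energy G \<mu> f \<le> 4 * l * (C * sq_norm \<Gamma> F)" using f(5) by (fold l_def) linarith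
      then show ?thesis using M C by (intro mult_left_mono) auto
    qed
    finally have one: "dirichlet_energy \<Gamma> \<eta> F \<le> M * (C * (4 * l * (C * sq_norm \<Gamma> F)))" .
    have "dirichlet_energy \<Gamma> (convolution_power \<Gamma> \<eta> (2 ^ k)) F \<le> 2 ^ k * dirichlet_energy \<Gamma> \<eta> F"
      by (rule \<Gamma>.dirichlet_energy_dyadic[OF F \<eta>])
    also have "\<dots> \<le> 2 ^ k * (M * (C * (4 * l * (C * sq_norm \<Gamma> F))))" using one by simp
    also have "\<dots> = (4 * M * C\<^sup>2 * (\<gamma> (4 ^ k) + ln 2) / 2 ^ k) * sq_norm \<Gamma> F"
    proof -
      have "(4::real) ^ k = 2 ^ k * 2 ^ k" by (simp flip: power_mult_distrib)
      then show ?thesis by (simp add: l_def power2_eq_square)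
    qed
    also have "\<dots> \<le> 2 * \<delta>\<^sup>2 * sq_norm \<Gamma> F" using k1 F_pos by (intro mult_right_mono) auto
    finally have "\<exists>V. finite V \<and> V \<noteq> {} \<and> card V \<le> card {y. F y \<noteq> 0}
        \<and> measure (convolution_power \<Gamma> \<eta> (2 ^ k)) (- V) \<le> \<delta>\<^sup>2"
      using F(1) F_pos \<Gamma>.prob_measure_on_convolution_power[OF \<eta>(1)] \<Gamma>.map_inv_convolution_power[OF \<eta>]
      by (intro \<Gamma>.concentration_of_small_energy)
    then obtain V where V: "finite V" "V \<noteq> {}" "card V \<le> card {y. F y \<noteq> 0}"
      and out: "measure (convolution_power \<Gamma> \<eta> (2 ^ k)) (- V) \<le> \<delta>\<^sup>2" by blast
    have "real (card V) \<le> C * card {x. f x \<noteq> 0}" using V(3) F_card by linarith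
    also have "\<dots> \<le> C * (16 * exp (\<gamma> (4 ^ k)))" using f(4) C by (intro mult_left_mono) auto
    finally have "ln (real (card V)) \<le> ln (C * (16 * exp (\<gamma> (4 ^ k))))"
      using V C by (subst ln_le_cancel_iff) (auto simp: card_gt_0_iff)
    also have "\<dots> = \<gamma> (4 ^ k) + ln (16 * C)" using C by (simp add: ln_mult)
    also have "\<dots> \<le> \<delta> * 2 ^ k" using k2 by (simp add: field_simps)
    finally have "ln (real (card V)) \<le> \<delta> * 2 ^ k" .
    then have "finite V \<and> V \<noteq> {} \<and> 1 \<le> \<delta> * 2 ^ k \<and> ln (real (card V)) \<le> \<delta> * 2 ^ k
        \<and> measure (convolution_power \<Gamma> \<eta> (2 ^ k)) (- V) \<le> \<delta>\<^sup>2" using V k3' out by (intro conjI)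
    then show "\<exists>k (U :: 'b set). finite U \<and> U \<noteq> {} \<and> 1 \<le> \<delta> * 2 ^ k \<and> ln (real (card U)) \<le> \<delta> * 2 ^ k
        \<and> measure (convolution_power \<Gamma> \<eta> (2 ^ k)) (- U) \<le> \<delta>\<^sup>2" by (intro exI)
  qed
qed

end
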